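(* Consider the relations $\sim_\alpha$ on closed terms over $\mathcal{K}_1$ (coded effectively by natural numbers). For every $k>0$, the relation $\sim_{\omega k}$ is $\Sigma^0_{2k+1}$-complete. For every $k\in\omega$ and every $n>0$, the relation $\sim_{\omega k+n}$ is $\Pi^0_{2k+2}$-complete.
   Context: Closed terms over a partial applicative structure $\mathcal{A}$ (a set with partial application $ab$, associating to the left) are built from elements by application; $s\simeq t$ means both undefined or both defined and equal. Relations $\sim_\alpha$ on closed terms: $s\sim_0 t$ iff $s\simeq t$; $s \sim_{\alpha+1} t$ iff $sx \sim_\alpha tx$ for all $x\in\mathcal{A}$; for limit $\alpha$, $s\sim_\alpha t$ iff $s\sim_\beta t$ for some $\beta<\alpha$. $\mathcal{K}_1$ is the pca on $\omega$ with $n\cdot m=\Phi_n(m)$ ($\Phi_n$ the $n$-th partial computable function). $\Gamma$-complete means definable in the arithmetical class $\Gamma$ and every $\Gamma$ set many-one reduces to it. *)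

theory Defs
  imports "HOL-Library.Nat_Bijection" "HOL-Library.Product_Lexorder"
begin

section \<open>Partial computable functions\<close>

text \<open>Unary partial recursive functions, tuples being coded by the Cantor pairing
  \<^const>\<open>prod_encode\<close>: the closure of zero, successor and the two projections under
  pairing, composition, primitive recursion and minimisation.\<close>

datatype recf =
    RZero | RSucc | RFst | RSnd
  | RPair recf recf | RComp recf recf | RPrec recf recf | RMu recf

text \<open>In the last clause, the least zero is only returned if all earlier values are defined.\<close>

primrec ev :: "recf \<Rightarrow> nat \<Rightarrow> nat option" where
  "ev RZero x = Some 0"
| "ev RSucc x = Some (Suc x)"
| "ev RFst x = Some (fst (prod_decode x))"
| "ev RSnd x = Some (snd (prod_decode x))"
| "ev (RPair c d) x =
     Option.bind (ev c x) (\<lambda>u. Option.bind (ev d x) (\<lambda>v. Some (prod_encode (u, v))))"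
| "ev (RComp c d) x = Option.bind (ev d x) (ev c)"
| "ev (RPrec c d) x =
     (let (a, n) = prod_decode x
      in rec_nat (ev c a)
           (\<lambda>m r. Option.bind r (\<lambda>v. ev d (prod_encode (a, prod_encode (m, v))))) n)"
| "ev (RMu c) x =
     (let P = (\<lambda>n. ev c (prod_encode (x, n)) = Some 0 \<and>
                    (\<forall>m<n. \<exists>v. ev c (prod_encode (x, m)) = Some (Suc v)))
      in if \<exists>n. P n then Some (LEAST n. P n) else None)"

primrec recf_encode :: "recf \<Rightarrow> nat" where
  "recf_encode RZero = 0"
| "recf_encode RSucc = 1"
| "recf_encode RFst = 2"
| "recf_encode RSnd = 3"
| "recf_encode (RPair c d) = 4 * prod_encode (recf_encode c, recf_encode d) + 4"
| "recf_encode (RComp c d) = 4 * prod_encode (recf_encode c, recf_encode d) + 5"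
| "recf_encode (RPrec c d) = 4 * prod_encode (recf_encode c, recf_encode d) + 6"
| "recf_encode (RMu c) = 4 * recf_encode c + 7"

lemma inj_recf_encode: "inj recf_encode"
proof (rule injI)
  show "c = d" if "recf_encode c = recf_encode d" for c d
    using that
  proof (induction c arbitrary: d)
    case (RPair c1 c2) then show ?case by (cases d) (simp_all, presburger+)
  next
    case (RComp c1 c2) then show ?case by (cases d) (simp_all, presburger+)
  next
    case (RPrec c1 c2) then show ?case by (cases d) (simp_all, presburger+)
  next
    case (RMu c) then show ?case by (cases d) (simp_all, presburger+)
  qed (case_tac d; simp)+
qed

lemma surj_recf_encode: "surj recf_encode"
proof -
  have "\<exists>c. recf_encode c = n" for n
  proof (induction n rule: less_induct)
    case (less n)
    show ?case
    proof (cases "n < 4")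
      case True
      then have "n = 0 \<or> n = 1 \<or> n = 2 \<or> n = 3" by auto
      then show ?thesis
        using recf_encode.simps(1-4) by metis
    next
      case False
      define m where "m = (n - 4) div 4"
      obtain a b where ab: "prod_encode (a, b) = m"
        by (metis prod_decode_inverse surj_pair)
      have "m < n" using False by (auto simp: m_def)
      moreover have "a \<le> m" "b \<le> m"
        using ab le_prod_encode_1 le_prod_encode_2 by metis+
      ultimately obtain c d e where cde: "recf_encode c = a" "recf_encode d = b" "recf_encode e = m"
        using less by (meson le_less_trans)
      have "n = 4*m+4 \<or> n = 4*m+5 \<or> n = 4*m+6 \<or> n = 4*m+7"
        using False unfolding m_def by presburger
      then show ?thesis
        using cde ab recf_encode.simps(5-8) by metis
    qed
  qed
  then show ?thesis by (metis surjI)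
qed

lemma bij_recf_encode: "bij recf_encode"
  using inj_recf_encode surj_recf_encode by (simp add: bij_def)

definition Phi :: "nat \<Rightarrow> nat \<Rightarrow> nat option" where
  "Phi n = ev (inv recf_encode n)"

definition computable :: "(nat \<Rightarrow> nat) \<Rightarrow> bool" where
  "computable f \<longleftrightarrow> (\<exists>e. \<forall>x. Phi e x = Some (f x))"

section \<open>The arithmetical hierarchy and many-one completeness\<close>

definition decidable :: "nat set \<Rightarrow> bool" where
  "decidable A \<longleftrightarrow> computable (\<lambda>x. if x \<in> A then 1 else 0)"

fun Sigma0 :: "nat \<Rightarrow> nat set set" and Pi0 :: "nat \<Rightarrow> nat set set" where
  "Sigma0 0 = {A. decidable A}"
| "Pi0 0 = {A. decidable A}"
| "Sigma0 (Suc n) = {A. \<exists>B\<in>Pi0 n. A = {x. \<exists>y. prod_encode (x, y) \<in> B}}"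
| "Pi0 (Suc n) = {A. \<exists>B\<in>Sigma0 n. A = {x. \<forall>y. prod_encode (x, y) \<in> B}}"

definition many_one_reducible :: "nat set \<Rightarrow> nat set \<Rightarrow> bool" where
  "many_one_reducible B A \<longleftrightarrow> (\<exists>f. computable f \<and> (\<forall>x. x \<in> B \<longleftrightarrow> f x \<in> A))"

definition complete_for :: "nat set set \<Rightarrow> nat set \<Rightarrow> bool" where
  "complete_for \<Gamma> A \<longleftrightarrow> A \<in> \<Gamma> \<and> (\<forall>B\<in>\<Gamma>. many_one_reducible B A)"

section \<open>Closed terms over a partial applicative structure\<close>

text \<open>A partial applicative structure is given by its application
  \<open>app :: 'a \<Rightarrow> 'a \<Rightarrow> 'a option\<close>, with \<^const>\<open>None\<close> meaning undefined.\<close>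

datatype 'a cterm = El 'a | App "'a cterm" "'a cterm"

primrec eval_term :: "('a \<Rightarrow> 'a \<Rightarrow> 'a option) \<Rightarrow> 'a cterm \<Rightarrow> 'a option" where
  "eval_term app (El a) = Some a"
| "eval_term app (App s t) =
     Option.bind (eval_term app s) (\<lambda>a. Option.bind (eval_term app t) (\<lambda>b. app a b))"

definition kleene_eq :: "('a \<Rightarrow> 'a \<Rightarrow> 'a option) \<Rightarrow> 'a cterm \<Rightarrow> 'a cterm \<Rightarrow> bool" where
  "kleene_eq app s t \<longleftrightarrow>
     (eval_term app s = None \<and> eval_term app t = None) \<or>
     (\<exists>a. eval_term app s = Some a \<and> eval_term app t = Some a)"

section \<open>The relations indexed by ordinals\<close>

text \<open>The elements of a well-ordered type play the role of the ordinals below its order type.\<close>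

definition is_zero :: "'o::wellorder \<Rightarrow> bool" where
  "is_zero \<alpha> \<longleftrightarrow> (\<forall>\<beta>. \<alpha> \<le> \<beta>)"

definition is_succ_of :: "'o::wellorder \<Rightarrow> 'o \<Rightarrow> bool" where
  "is_succ_of \<alpha> \<beta> \<longleftrightarrow> \<beta> < \<alpha> \<and> (\<forall>\<gamma>. \<beta> < \<gamma> \<longrightarrow> \<alpha> \<le> \<gamma>)"

definition is_limit :: "'o::wellorder \<Rightarrow> bool" where
  "is_limit \<alpha> \<longleftrightarrow> \<not> is_zero \<alpha> \<and> (\<nexists>\<beta>. is_succ_of \<alpha> \<beta>)"

inductive sim ::
  "('a \<Rightarrow> 'a \<Rightarrow> 'a option) \<Rightarrow> 'o::wellorder \<Rightarrow> 'a cterm \<Rightarrow> 'a cterm \<Rightarrow> bool" for app where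
  zero: "sim app \<alpha> s t" if "is_zero \<alpha>" "kleene_eq app s t"
| succ: "sim app \<alpha> s t" if "is_succ_of \<alpha> \<beta>" "\<And>x. sim app \<beta> (App s (El x)) (App t (El x))"
| limit: "sim app \<alpha> s t" if "is_limit \<alpha>" "\<beta> < \<alpha>" "sim app \<beta> s t"

lemma succ_not_zero: "is_succ_of \<alpha> \<beta> \<Longrightarrow> \<not> is_zero \<alpha>"
  unfolding is_succ_of_def is_zero_def by (meson leD)

lemma is_succ_of_unique: "is_succ_of \<alpha> \<beta> \<Longrightarrow> is_succ_of \<alpha> \<gamma> \<Longrightarrow> \<beta> = \<gamma>"
  unfolding is_succ_of_def by (meson leD not_less_iff_gr_or_eq)

lemma sim_zero_iff: "is_zero \<alpha> \<Longrightarrow> sim app \<alpha> s t \<longleftrightarrow> kleene_eq app s t"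
  by (auto simp: is_limit_def dest: succ_not_zero elim: sim.cases intro: sim.zero)

lemma sim_succ_iff:
  "is_succ_of \<alpha> \<beta> \<Longrightarrow> sim app \<alpha> s t \<longleftrightarrow> (\<forall>x. sim app \<beta> (App s (El x)) (App t (El x)))"
  by (subst sim.simps) (metis is_limit_def succ_not_zero is_succ_of_unique)

lemma sim_limit_iff: "is_limit \<alpha> \<Longrightarrow> sim app \<alpha> s t \<longleftrightarrow> (\<exists>\<beta><\<alpha>. sim app \<beta> s t)"
  by (auto simp: is_limit_def elim: sim.cases intro: sim.limit)

text \<open>The lexicographic order on pairs of natural numbers has order type $\omega^2$, the pair
  $(k, n)$ being in position $\omega k + n$.\<close>

type_synonym ord_below_omega_sq = "nat \<times> nat"

definition omega_times_plus :: "nat \<Rightarrow> nat \<Rightarrow> ord_below_omega_sq" where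
  "omega_times_plus k n = (k, n)"

lemma is_zero_omega: "is_zero (omega_times_plus 0 0)"
  by (auto simp: is_zero_def omega_times_plus_def less_eq_prod_def)

lemma is_succ_of_omega: "is_succ_of (omega_times_plus k (Suc n)) (omega_times_plus k n)"
  by (auto simp: is_succ_of_def omega_times_plus_def less_eq_prod_def less_prod_def)

lemma is_limit_omega: "is_limit (omega_times_plus (Suc k) 0)"
proof -
  have "\<not> is_succ_of (omega_times_plus (Suc k) 0) \<beta>" for \<beta>
  proof
    assume a: "is_succ_of (omega_times_plus (Suc k) 0) \<beta>"
    obtain j m where "\<beta> = (j, m)" by (cases \<beta>)
    with a have "(j, m) < (Suc k, 0)" "\<And>\<gamma>. (j, m) < \<gamma> \<Longrightarrow> (Suc k, 0) \<le> \<gamma>"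
      by (auto simp: is_succ_of_def omega_times_plus_def)
    from this(1) this(2)[of "(j, Suc m)"] show False
      by (auto simp: less_prod_def less_eq_prod_def)
  qed
  moreover have "\<not> is_zero (omega_times_plus (Suc k) 0)"
    by (auto simp: is_zero_def omega_times_plus_def less_eq_prod_def)
  ultimately show ?thesis by (auto simp: is_limit_def)
qed

section \<open>The relations over the first Kleene algebra, as sets of natural numbers\<close>

definition K1_app :: "nat \<Rightarrow> nat \<Rightarrow> nat option" where
  "K1_app n m = Phi n m"

primrec cterm_encode :: "nat cterm \<Rightarrow> nat" where
  "cterm_encode (El a) = 2 * a"
| "cterm_encode (App s t) = 2 * prod_encode (cterm_encode s, cterm_encode t) + 1"

lemma inj_cterm_encode: "inj cterm_encode"
proof (rule injI)
  show "s = t" if "cterm_encode s = cterm_encode t" for s t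
    using that
  proof (induction s arbitrary: t)
    case (El a) then show ?case by (cases t) (simp_all, presburger+)
  next
    case (App s1 s2) then show ?case by (cases t) (simp_all, presburger+)
  qed
qed

definition K1_sim :: "ord_below_omega_sq \<Rightarrow> nat set" where
  "K1_sim \<alpha> = {prod_encode (cterm_encode s, cterm_encode t) | s t. sim K1_app \<alpha> s t}"

end

theory Submission
  imports Defs
begin

text \<open>Upper bounds: a closed term has a value iff there is a finite, decidably checkable
  certificate, so \<open>\<sim>\<^sub>0\<close> is \<open>\<Pi>\<^sub>2\<close>; \<open>s \<sim> t\<close> at \<open>\<omega>k + n\<close> says that \<open>s l\<close> and \<open>t l\<close> are related at \<open>\<omega>k\<close>
  for all \<open>n\<close>-tuples \<open>l\<close>, and a limit stage adds an existential quantifier over \<open>n\<close>.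

  Lower bounds: by induction on \<open>k\<close>, for every \<open>\<Sigma>\<^sub>2\<^sub>k\<^sub>+\<^sub>1\<close> set \<open>A\<close> there are computable \<open>F\<close> and \<open>G\<close> such
  that \<open>F(x,m)\<close> and \<open>G(x,m)\<close> are related at \<open>\<omega>k + n\<close> iff \<open>x \<in> A\<close> or \<open>n > m\<close>. For \<open>k = 0\<close>, \<open>G(x,m)\<close> is
  \<open>K\<^sup>m\<close> applied to a code of the nowhere defined function, and \<open>F(x,m)\<close> evaluates to the same number
  if \<open>x \<in> A\<close> and is undefined otherwise. For the step, write \<open>x \<in> A\<close> as
  \<open>\<exists>m. \<forall>z. D(x,m,z)\<close> with \<open>\<forall>z. D(x,m,z)\<close> monotone in \<open>m\<close>, so that \<open>\<exists>m\<close> may be read as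
  ``for almost all \<open>m\<close>''. The functions mapping \<open>m\<close>, \<open>z\<close> to \<open>F((x,m,z),m)\<close> and to \<open>G((x,m,z),m)\<close> are related
  at \<open>\<omega>k + n + 2\<close> iff \<open>\<forall>z. D(x,m,z)\<close> holds for all \<open>m \<ge> n\<close>, hence at \<open>\<omega>(k + 1)\<close> iff \<open>x \<in> A\<close>; and
  always at \<open>\<omega>(k + 1) + 1\<close>.\<close>

section \<open>Computable functions and decidable sets\<close>

abbreviation pair :: "nat \<Rightarrow> nat \<Rightarrow> nat" where
  "pair x y \<equiv> prod_encode (x, y)"

abbreviation pfst :: "nat \<Rightarrow> nat" where
  "pfst p \<equiv> fst (prod_decode p)"

abbreviation psnd :: "nat \<Rightarrow> nat" where
  "psnd p \<equiv> snd (prod_decode p)"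

lemma pair_pfst_psnd: "pair (pfst p) (psnd p) = p"
  by simp

lemma Phi_recf_encode: "Phi (recf_encode c) = ev c"
  by (simp add: Phi_def inv_f_f inj_recf_encode)

lemma computable_iff_ev: "computable f \<longleftrightarrow> (\<exists>c. \<forall>x. ev c x = Some (f x))"
  unfolding computable_def Phi_def by (metis Phi_def Phi_recf_encode)

lemma computableI: "(\<And>x. ev c x = Some (f x)) \<Longrightarrow> computable f"
  by (auto simp: computable_iff_ev)

lemma computableE:
  assumes "computable f"
  obtains c where "\<And>x. ev c x = Some (f x)"
  using assms by (auto simp: computable_iff_ev)

lemma computable_id: "computable (\<lambda>x. x)"
  \<comment> \<open>The language has no identity program, but pairing the two projections restores
    the input.\<close>
  by (rule computableI[of "RPair RFst RSnd"]) simp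

lemma computable_comp: "computable f \<Longrightarrow> computable g \<Longrightarrow> computable (\<lambda>x. f (g x))"
  by (elim computableE, rule_tac c = "RComp c ca" in computableI) simp

lemma computable_Suc: "computable f \<Longrightarrow> computable (\<lambda>x. Suc (f x))"
  by (elim computableE, rule_tac c = "RComp RSucc c" in computableI) simp

lemma computable_const: "computable (\<lambda>x. n)"
proof (induction n)
  case 0
  show ?case by (rule computableI[of RZero]) simp
qed (rule computable_Suc)

lemma computable_pfst: "computable f \<Longrightarrow> computable (\<lambda>x. pfst (f x))"
  by (elim computableE, rule_tac c = "RComp RFst c" in computableI) simp

lemma computable_psnd: "computable f \<Longrightarrow> computable (\<lambda>x. psnd (f x))"
  by (elim computableE, rule_tac c = "RComp RSnd c" in computableI) simp

lemma computable_pair: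
  "computable f \<Longrightarrow> computable g \<Longrightarrow> computable (\<lambda>x. pair (f x) (g x))"
  by (elim computableE, rule_tac c = "RPair c ca" in computableI) simp

text \<open>The parameter of \<open>RPrec\<close> is taken to be \<open>x\<close> itself, so that
  both the initial value and the step may depend on it.\<close>

lemma computable_rec_nat:
  assumes "computable f" "computable n"
    and "computable (\<lambda>p. h (pfst p) (pfst (psnd p)) (psnd (psnd p)))"
  shows "computable (\<lambda>x. rec_nat (f x) (h x) (n x))"
proof -
  obtain cf ch cn where
    c: "\<And>x. ev cf x = Some (f x)" "\<And>x. ev cn x = Some (n x)"
      "\<And>p. ev ch p = Some (h (pfst p) (pfst (psnd p)) (psnd (psnd p)))"
    using assms by (auto simp: computable_iff_ev)
  have "ev (RPrec cf ch) (pair x k) = Some (rec_nat (f x) (h x) k)" for x k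
    by (induction k) (simp_all add: c)
  then show ?thesis
    by (intro computableI[of "RComp (RPrec cf ch) (RPair (RPair RFst RSnd) cn)"]) (simp add: c)
qed

lemmas computable_basic_intros =
  computable_const computable_id computable_Suc computable_pfst computable_psnd computable_pair

lemma computable_add:
  assumes "computable f" "computable g"
  shows "computable (\<lambda>x. f x + g x)"
proof -
  have *: "rec_nat (f x) (\<lambda>_. Suc) n = f x + n" for x n
    by (induction n) auto
  have "computable (\<lambda>x. rec_nat (f x) (\<lambda>_. Suc) (g x))"
    by (intro computable_rec_nat assms computable_basic_intros)
  then show ?thesis by (simp add: *)
qed

lemma computable_mult:
  assumes "computable f" "computable g"
  shows "computable (\<lambda>x. f x * g x)"
proof -
  have *: "rec_nat 0 (\<lambda>_ r. f x + r) n = f x * n" for x n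
    by (induction n) auto
  have "computable (\<lambda>x. rec_nat 0 (\<lambda>_ r. f x + r) (g x))"
    by (intro computable_rec_nat assms computable_basic_intros computable_add
        computable_comp[OF assms(1)])
  then show ?thesis by (simp add: *)
qed

lemma computable_diff:
  assumes "computable f" "computable g"
  shows "computable (\<lambda>x. f x - g x)"
proof -
  \<comment> \<open>A recursion that ignores its accumulator and returns its counter computes the
    predecessor.\<close>
  have pred: "rec_nat 0 (\<lambda>m _. m) n = n - 1" for n
    by (cases n) auto
  have diff: "rec_nat (f x) (\<lambda>_ r. rec_nat 0 (\<lambda>m _. m) r) n = f x - n" for x n
    by (induction n) (auto simp: pred)
  have "computable (\<lambda>x. rec_nat (f x) (\<lambda>_ r. rec_nat 0 (\<lambda>m _. m) r) (g x))"
    by (intro computable_rec_nat assms computable_basic_intros)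
  then show ?thesis by (simp add: diff)
qed

lemma decidable_le:
  assumes "computable f" "computable g"
  shows "decidable {x. f x \<le> g x}"
proof -
  \<comment> \<open>Truncated subtraction makes this the characteristic function.\<close>
  have "computable (\<lambda>x. 1 - (f x - g x))"
    by (intro computable_diff computable_const assms)
  also have "(\<lambda>x. 1 - (f x - g x)) = (\<lambda>x. if x \<in> {x. f x \<le> g x} then 1 else 0)"
    by auto
  finally show ?thesis by (simp add: decidable_def)
qed

lemma decidable_conj:
  assumes "decidable {x. P x}" "decidable {x. Q x}"
  shows "decidable {x. P x \<and> Q x}"
proof -
  have "computable (\<lambda>x. (if x \<in> {x. P x} then 1 else 0) * (if x \<in> {x. Q x} then 1 else 0))"
    using assms unfolding decidable_def by (rule computable_mult)
  also have "(\<lambda>x. (if x \<in> {x. P x} then 1 else 0) * (if x \<in> {x. Q x} then 1 else 0)) =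
    (\<lambda>x. if x \<in> {x. P x \<and> Q x} then 1 else 0 :: nat)"
    by auto
  finally show ?thesis by (simp add: decidable_def)
qed

lemma decidable_not:
  assumes "decidable {x. P x}"
  shows "decidable {x. \<not> P x}"
proof -
  have "computable (\<lambda>x. 1 - (if x \<in> {x. P x} then 1 else 0))"
    using assms unfolding decidable_def by (intro computable_diff computable_const)
  also have "(\<lambda>x. 1 - (if x \<in> {x. P x} then 1 else 0)) =
    (\<lambda>x. if x \<in> {x. \<not> P x} then 1 else 0 :: nat)"
    by auto
  finally show ?thesis by (simp add: decidable_def)
qed

lemma decidable_disj:
  assumes "decidable {x. P x}" "decidable {x. Q x}"
  shows "decidable {x. P x \<or> Q x}"
  using decidable_not[OF decidable_conj[OF assms[THEN decidable_not]]] by simp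

lemma decidable_imp:
  assumes "decidable {x. P x}" "decidable {x. Q x}"
  shows "decidable {x. P x \<longrightarrow> Q x}"
  using decidable_disj[OF decidable_not[OF assms(1)] assms(2)] by (simp only: imp_conv_disj)

lemma decidable_eq:
  assumes "computable f" "computable g"
  shows "decidable {x. f x = g x}"
  using decidable_conj[OF decidable_le[OF assms] decidable_le[OF assms(2,1)]]
  by (simp only: order.eq_iff[symmetric])

lemma decidable_less:
  assumes "computable f" "computable g"
  shows "decidable {x. f x < g x}"
  using decidable_not[OF decidable_le[OF assms(2,1)]] by (simp add: not_le)

lemma decidable_vimage:
  assumes "decidable A" "computable f"
  shows "decidable {x. f x \<in> A}"
  using computable_comp[OF _ assms(2), of "\<lambda>x. if x \<in> A then 1 else 0"] assms(1)
  by (simp add: decidable_def)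

lemma computable_if:
  assumes "decidable {x. P x}" "computable f" "computable g"
  shows "computable (\<lambda>x. if P x then f x else g x)"
proof -
  have "computable (\<lambda>x. (if x \<in> {x. P x} then 1 else 0) * f x +
      (1 - (if x \<in> {x. P x} then 1 else 0)) * g x)"
    using assms unfolding decidable_def
    by (intro computable_add computable_mult computable_diff computable_const)
  also have "(\<lambda>x. (if x \<in> {x. P x} then 1 else 0) * f x +
      (1 - (if x \<in> {x. P x} then 1 else 0)) * g x) = (\<lambda>x. if P x then f x else g x)"
    by auto
  finally show ?thesis .
qed

lemma decidable_bex:
  assumes "computable b" "decidable {p. P (pfst p) (psnd p)}"
  shows "decidable {x. \<exists>y\<le>b x. P x y}"
proof -
  have *: "rec_nat 0 (\<lambda>y r. if P x y then 1 else r) n = (if \<exists>y<n. P x y then 1 else 0 :: nat)"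
    for x n
    by (induction n) (auto simp: less_Suc_eq)
  \<comment> \<open>The recursion step receives counter and accumulator together, so
    \<open>P\<close> is pulled back along the map forgetting the accumulator.\<close>
  have "decidable {p. P (pfst p) (pfst (psnd p))}"
    using decidable_vimage[OF assms(2), of "\<lambda>p. pair (pfst p) (pfst (psnd p))"]
    by (simp add: computable_basic_intros)
  then have "computable (\<lambda>x. rec_nat 0 (\<lambda>y r. if P x y then 1 else r) (Suc (b x)))"
    by (intro computable_rec_nat computable_basic_intros computable_if assms)
  then show ?thesis
    by (simp only: * decidable_def less_Suc_eq_le mem_Collect_eq)
qed

lemma decidable_ball:
  assumes "computable b" "decidable {p. P (pfst p) (psnd p)}"
  shows "decidable {x. \<forall>y\<le>b x. P x y}"
  using decidable_not[OF decidable_bex[OF assms(1) decidable_not[OF assms(2)]]] by simp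

text \<open>A number codes the sequence of the first components of its iterated second components.\<close>

definition entry :: "nat \<Rightarrow> nat \<Rightarrow> nat" where
  "entry l i = pfst (rec_nat l (\<lambda>_. psnd) i)"

lemma entry_0: "entry (pair a l) 0 = a"
  by (simp add: entry_def)

lemma entry_Suc: "entry (pair a l) (Suc i) = entry l i"
proof -
  have "rec_nat (pair a l) (\<lambda>_. psnd) (Suc i) = rec_nat l (\<lambda>_. psnd) i"
    by (induction i) auto
  then show ?thesis by (simp add: entry_def)
qed

lemma ex_entries: "\<exists>l. \<forall>i<n. entry l i = f i"
proof (induction n arbitrary: f)
  case (Suc n)
  obtain l where "\<forall>i<n. entry l i = f (Suc i)" using Suc[of "\<lambda>i. f (Suc i)"] by blast
  then have "\<forall>i<Suc n. entry (pair (f 0) l) i = f i"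
    by (auto simp: entry_0 entry_Suc less_Suc_eq_0_disj)
  then show ?case by blast
qed simp

lemma pfst_le: "pfst p \<le> p"
  by (metis le_prod_encode_1 pair_pfst_psnd)

lemma psnd_le: "psnd p \<le> p"
  by (metis le_prod_encode_2 pair_pfst_psnd)

lemma entry_le: "entry l i \<le> l"
proof -
  have "rec_nat l (\<lambda>_. psnd) i \<le> l"
    by (induction i) (auto intro: order_trans[OF psnd_le])
  then show ?thesis
    unfolding entry_def using pfst_le order_trans by blast
qed

lemma computable_entry:
  assumes "computable f" "computable g"
  shows "computable (\<lambda>x. entry (f x) (g x))"
  unfolding entry_def by (intro computable_basic_intros computable_rec_nat assms)

text \<open>A code is a length paired with a sequence. The bound \<open>i \<le> pfst N\<close> gives
  the shape that \<open>decidable_bex\<close> handles, and the strict one lets length 0 code the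
  empty set.\<close>

definition fin_set :: "nat \<Rightarrow> nat set" where
  "fin_set N = {p. \<exists>i\<le>pfst N. i < pfst N \<and> p = entry (psnd N) i}"

lemma fin_set_le: "p \<in> fin_set N \<Longrightarrow> p \<le> N"
  unfolding fin_set_def using entry_le psnd_le order_trans by blast

lemma ex_fin_set:
  assumes "finite A"
  shows "\<exists>N. fin_set N = A"
proof -
  obtain n f where A: "A = f ` {i::nat. i < n}"
    using assms by (auto simp: finite_conv_nat_seg_image)
  obtain l where "\<forall>i<n. entry l i = f i" using ex_entries by blast
  then have "entry l ` {i. i < n} = A" unfolding A by (intro image_cong) auto
  moreover have "fin_set (pair n l) = entry l ` {i. i < n}"
    by (auto simp: fin_set_def intro: less_imp_le)
  ultimately have "fin_set (pair n l) = A" by simp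
  then show ?thesis by blast
qed

lemma decidable_mem_fin_set:
  assumes "computable f" "computable g"
  shows "decidable {x. f x \<in> fin_set (g x)}"
  unfolding fin_set_def mem_Collect_eq
  by (intro decidable_bex decidable_conj decidable_less decidable_eq computable_entry
      computable_basic_intros computable_comp[OF assms(1)] computable_comp[OF assms(2)] assms)

lemmas computable_intros =
  computable_basic_intros computable_add computable_mult computable_diff computable_entry

lemmas decidable_intros =
  decidable_conj decidable_disj decidable_not decidable_eq decidable_le decidable_less
  decidable_bex decidable_ball decidable_mem_fin_set decidable_imp

section \<open>Certificates for evaluation\<close>

text \<open>The number \<open>claim c x v\<close> asserts that the function with code \<open>c\<close> takes the value \<open>v\<close> at
  \<open>x\<close>. A set of claims each of which is justified by other members of the set consists of
  true claims only, although nothing is said about the order of the derivation: each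
  justification decreases the code, or keeps it and decreases the recursion argument. For
  \<open>B = {..N}\<close> all quantifiers are bounded, so the condition becomes decidable.\<close>

abbreviation claim :: "nat \<Rightarrow> nat \<Rightarrow> nat \<Rightarrow> nat" where
  "claim c x v \<equiv> pair c (pair x v)"

definition justified :: "nat set \<Rightarrow> nat set \<Rightarrow> nat \<Rightarrow> nat \<Rightarrow> nat \<Rightarrow> bool" where
  "justified F B c x v \<longleftrightarrow>
     c = 0 \<and> v = 0 \<or> c = 1 \<and> v = Suc x \<or> c = 2 \<and> v = pfst x \<or> c = 3 \<and> v = psnd x \<or>
     (\<exists>d\<in>B. \<exists>e\<in>B. c = 4 * pair d e + 4 \<and>
        (\<exists>u\<in>B. \<exists>w\<in>B. claim d x u \<in> F \<and> claim e x w \<in> F \<and> v = pair u w)) \<or>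
     (\<exists>d\<in>B. \<exists>e\<in>B. c = 4 * pair d e + 5 \<and> (\<exists>u\<in>B. claim e x u \<in> F \<and> claim d u v \<in> F)) \<or>
     (\<exists>d\<in>B. \<exists>e\<in>B. c = 4 * pair d e + 6 \<and>
        (psnd x = 0 \<and> claim d (pfst x) v \<in> F \<or>
         (\<exists>m\<in>B. \<exists>r\<in>B. psnd x = Suc m \<and> claim c (pair (pfst x) m) r \<in> F \<and>
            claim e (pair (pfst x) (pair m r)) v \<in> F))) \<or>
     (\<exists>d\<in>B. c = 4 * d + 7 \<and> claim d (pair x v) 0 \<in> F \<and>
        (\<forall>m\<le>v. m < v \<longrightarrow> (\<exists>w\<in>B. claim d (pair x m) (Suc w) \<in> F)))"

text \<open>Both sets occur only positively, also under the universal quantifier of the minimisation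
  clause.\<close>

lemma justified_mono: "justified F B c x v \<Longrightarrow> F \<subseteq> F' \<Longrightarrow> B \<subseteq> B' \<Longrightarrow> justified F' B' c x v"
  unfolding justified_def
  unfolding Bex_def
  by (assumption | (erule subsetD, assumption)
      | erule disj_forward conj_forward ex_forward all_forward imp_forward)+

lemma pair_leD: "pair a b \<le> N \<Longrightarrow> a \<le> N \<and> b \<le> N"
  using le_prod_encode_1 le_prod_encode_2 order_trans by blast

text \<open>Every witness is a component of some claim in \<open>F\<close> or of the code
  \<open>c\<close>, and a component of a pair is at most the pair.\<close>

lemma justified_atMost:
  assumes "F \<subseteq> {..N}" "c \<le> N" "justified F UNIV c x v"
  shows "justified F {..N} c x v"
proof -
  have fact: "a \<le> N \<and> b \<le> N \<and> w \<le> N" if "claim a b w \<in> F" for a b w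
    using that assms(1) pair_leD by blast
  have code: "d \<le> N \<and> e \<le> N" if "c = 4 * pair d e + k" for d e k
  proof -
    have "pair d e \<le> N" using that assms(2) by linarith
    then show ?thesis by (rule pair_leD)
  qed
  from assms(3) show ?thesis
    unfolding justified_def
  proof (elim disj_forward, goal_cases)
    case 5
    then obtain d e u w where *: "c = 4 * pair d e + 4" "claim d x u \<in> F" "claim e x w \<in> F"
      "v = pair u w" by blast
    then have "d \<in> {..N}" "e \<in> {..N}" "u \<in> {..N}" "w \<in> {..N}"
      using code[OF *(1)] fact by auto
    then show ?case using * by blast
  next
    case 6
    then obtain d e u where *: "c = 4 * pair d e + 5" "claim e x u \<in> F" "claim d u v \<in> F"
      by blast
    then have "d \<in> {..N}" "e \<in> {..N}" "u \<in> {..N}"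
      using code[OF *(1)] fact by auto
    then show ?case using * by blast
  next
    case 7
    then obtain d e where c: "c = 4 * pair d e + 6" and
      de: "psnd x = 0 \<and> claim d (pfst x) v \<in> F \<or>
         (\<exists>m. \<exists>r. psnd x = Suc m \<and> claim c (pair (pfst x) m) r \<in> F \<and>
            claim e (pair (pfst x) (pair m r)) v \<in> F)" by blast
    have "d \<in> {..N}" "e \<in> {..N}" using code[OF c] by auto
    moreover have "psnd x = 0 \<and> claim d (pfst x) v \<in> F \<or>
         (\<exists>m\<in>{..N}. \<exists>r\<in>{..N}. psnd x = Suc m \<and> claim c (pair (pfst x) m) r \<in> F \<and>
            claim e (pair (pfst x) (pair m r)) v \<in> F)"
      using de
    proof (elim disjE exE conjE)
      fix m r
      assume *: "psnd x = Suc m" "claim c (pair (pfst x) m) r \<in> F"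
        "claim e (pair (pfst x) (pair m r)) v \<in> F"
      then have "m \<in> {..N}" "r \<in> {..N}"
        using fact[OF *(2)] pair_leD[of "pfst x" m N] by auto
      then show ?thesis using * by blast
    qed simp
    ultimately show ?case
      by - (rule bexI[of _ d], rule bexI[of _ e], rule conjI[OF c])
  next
    case 8
    then obtain d where d: "d \<in> UNIV" "c = 4 * d + 7" "claim d (pair x v) 0 \<in> F"
      and w: "\<forall>m\<le>v. m < v \<longrightarrow> (\<exists>w\<in>UNIV. claim d (pair x m) (Suc w) \<in> F)"
      by (elim bexE conjE)
    have "\<exists>w\<in>{..N}. claim d (pair x m) (Suc w) \<in> F" if m: "m < v" for m
    proof -
      obtain w where "claim d (pair x m) (Suc w) \<in> F" using w m by (auto dest: less_imp_le)
      moreover from this have "w \<in> {..N}" using fact by force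
      ultimately show ?thesis by blast
    qed
    then have "\<forall>m\<le>v. m < v \<longrightarrow> (\<exists>w\<in>{..N}. claim d (pair x m) (Suc w) \<in> F)" by simp
    moreover have "d \<in> {..N}" using fact d(3) by auto
    ultimately show ?case
      by - (rule bexI[of _ d], intro conjI d)
  qed simp_all
qed

definition closed_claims :: "nat set \<Rightarrow> bool" where
  "closed_claims F \<longleftrightarrow> (\<forall>c x v. claim c x v \<in> F \<longrightarrow> justified F UNIV c x v)"

text \<open>The residue modulo 4 determines the outermost constructor, so at most one clause of
  \<open>justified\<close> applies to a given code.\<close>

lemma code_shape_neq:
  fixes a b :: nat
  shows "4 * a + 4 \<noteq> 4 * b + 5" "4 * a + 4 \<noteq> 4 * b + 6" "4 * a + 4 \<noteq> 4 * b + 7"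
    "4 * a + 5 \<noteq> 4 * b + 4" "4 * a + 5 \<noteq> 4 * b + 6" "4 * a + 5 \<noteq> 4 * b + 7"
    "4 * a + 6 \<noteq> 4 * b + 4" "4 * a + 6 \<noteq> 4 * b + 5" "4 * a + 6 \<noteq> 4 * b + 7"
    "4 * a + 7 \<noteq> 4 * b + 4" "4 * a + 7 \<noteq> 4 * b + 5" "4 * a + 7 \<noteq> 4 * b + 6"
  by presburger+

lemma justified_RPair:
  "justified F UNIV (4 * pair d e + 4) x v \<longleftrightarrow>
     (\<exists>u w. claim d x u \<in> F \<and> claim e x w \<in> F \<and> v = pair u w)"
  unfolding justified_def by (simp add: code_shape_neq)

lemma justified_RComp:
  "justified F UNIV (4 * pair d e + 5) x v \<longleftrightarrow> (\<exists>u. claim e x u \<in> F \<and> claim d u v \<in> F)"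
  unfolding justified_def by (simp add: code_shape_neq)

lemma justified_RPrec:
  "justified F UNIV (4 * pair d e + 6) x v \<longleftrightarrow>
     psnd x = 0 \<and> claim d (pfst x) v \<in> F \<or>
     (\<exists>m r. psnd x = Suc m \<and> claim (4 * pair d e + 6) (pair (pfst x) m) r \<in> F \<and>
        claim e (pair (pfst x) (pair m r)) v \<in> F)"
  unfolding justified_def by (simp add: code_shape_neq)

lemma justified_RMu:
  "justified F UNIV (4 * d + 7) x v \<longleftrightarrow> claim d (pair x v) 0 \<in> F \<and>
     (\<forall>m<v. \<exists>w. claim d (pair x m) (Suc w) \<in> F)"
  unfolding justified_def by (auto simp: code_shape_neq)

lemmas justified_recf_encode =
  justified_RPair justified_RComp justified_RPrec justified_RMu

lemma ev_sound:
  assumes "closed_claims F" "claim (recf_encode c) x v \<in> F"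
  shows "ev c x = Some v"
  using assms(2)
proof (induction c arbitrary: x v)
  case RZero
  then show ?case using assms(1) unfolding closed_claims_def justified_def by fastforce
next
  case RSucc
  then show ?case using assms(1) unfolding closed_claims_def justified_def by fastforce
next
  case RFst
  then show ?case using assms(1) unfolding closed_claims_def justified_def by fastforce
next
  case RSnd
  then show ?case using assms(1) unfolding closed_claims_def justified_def by fastforce
next
  case (RPair c d)
  have J: "justified F UNIV (4 * pair (recf_encode c) (recf_encode d) + 4) x v"
    using assms(1) RPair.prems unfolding closed_claims_def by simp
  have "\<exists>u w. claim (recf_encode c) x u \<in> F \<and> claim (recf_encode d) x w \<in> F \<and> v = pair u w"
    using J by (simp add: justified_recf_encode)
  then show ?case using RPair.IH by auto
next
  case (RComp c d)
  have J: "justified F UNIV (4 * pair (recf_encode c) (recf_encode d) + 5) x v"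
    using assms(1) RComp.prems unfolding closed_claims_def by simp
  then show ?case using RComp.IH by (fastforce simp: justified_recf_encode)
next
  case (RPrec c d)
  \<comment> \<open>A claim at \<open>Suc n\<close> rests on a claim about the same program at
    \<open>n\<close>, which the induction on programs does not cover; hence an inner induction on
    \<open>n\<close>.\<close>
  have "ev (RPrec c d) (pair a n) = Some v" if "claim (recf_encode (RPrec c d)) (pair a n) v \<in> F"
    for a n v
    using that
  proof (induction n arbitrary: v)
    case 0
    then have J: "justified F UNIV (4 * pair (recf_encode c) (recf_encode d) + 6) (pair a 0) v"
      using assms(1) unfolding closed_claims_def by simp
    have "claim (recf_encode c) a v \<in> F"
      using J by (simp add: justified_recf_encode)
    then show ?case using RPrec.IH by simp
  next
    case (Suc n)
    then have J: "justified F UNIV (recf_encode (RPrec c d)) (pair a (Suc n)) v"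
      using assms(1) unfolding closed_claims_def by blast
    have "\<exists>r. claim (recf_encode (RPrec c d)) (pair a n) r \<in> F \<and>
        claim (recf_encode d) (pair a (pair n r)) v \<in> F"
      using J by (auto simp: justified_recf_encode)
    then show ?case using Suc.IH RPrec.IH by fastforce
  qed
  from this[of "pfst x" "psnd x"] show ?case using RPrec.prems by simp
next
  case (RMu c)
  have J: "justified F UNIV (4 * recf_encode c + 7) x v"
    using assms(1) RMu.prems unfolding closed_claims_def by simp
  have "claim (recf_encode c) (pair x v) 0 \<in> F \<and>
      (\<forall>m<v. \<exists>w. claim (recf_encode c) (pair x m) (Suc w) \<in> F)"
    using J by (simp add: justified_recf_encode)
  then have P: "ev c (pair x v) = Some 0 \<and> (\<forall>m<v. \<exists>w. ev c (pair x m) = Some (Suc w))"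
    using RMu.IH by blast
  \<comment> \<open>A smaller candidate would have value 0 at an argument where a successor is
    certified.\<close>
  then have "(LEAST n. ev c (pair x n) = Some 0 \<and>
      (\<forall>m<n. \<exists>w. ev c (pair x m) = Some (Suc w))) = v"
    by (intro Least_equality) (auto, metis nat.distinct(1) not_le option.inject)
  moreover have "\<exists>n. ev c (pair x n) = Some 0 \<and>
      (\<forall>m<n. \<exists>w. ev c (pair x m) = Some (Suc w))"
    using P by blast
  ultimately show ?case by (simp only: ev.simps Let_def if_True)
qed

definition derivable :: "nat \<Rightarrow> bool" where
  "derivable p \<longleftrightarrow> (\<exists>F. finite F \<and> closed_claims F \<and> p \<in> F)"

text \<open>By monotonicity of \<open>justified\<close>, a union of closed sets is closed, so
  finitely many derivations merge into one.\<close>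

lemma derivable_set:
  assumes "finite G" "\<And>p. p \<in> G \<Longrightarrow> derivable p"
  shows "\<exists>F. finite F \<and> closed_claims F \<and> G \<subseteq> F"
proof -
  obtain h where h: "\<And>p. p \<in> G \<Longrightarrow> finite (h p) \<and> closed_claims (h p) \<and> p \<in> h p"
    using assms(2) unfolding derivable_def by metis
  have "closed_claims (\<Union>p\<in>G. h p)"
    unfolding closed_claims_def
  proof (intro allI impI)
    fix c x v
    assume "claim c x v \<in> (\<Union>p\<in>G. h p)"
    then obtain p where p: "p \<in> G" "claim c x v \<in> h p" by blast
    then have "justified (h p) UNIV c x v" using h closed_claims_def by blast
    then show "justified (\<Union>p\<in>G. h p) UNIV c x v"
      by (rule justified_mono) (use p in auto)
  qed
  then show ?thesis using assms(1) h by (intro exI[of _ "\<Union>p\<in>G. h p"]) auto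
qed

lemma derivableI:
  assumes "finite G" "\<And>p. p \<in> G \<Longrightarrow> derivable p" "justified G UNIV c x v"
  shows "derivable (claim c x v)"
proof -
  obtain F where F: "finite F" "closed_claims F" "G \<subseteq> F"
    using derivable_set[OF assms(1,2)] by blast
  have "justified F UNIV c x v"
    using assms(3) F(3) by (rule justified_mono) simp
  then have "closed_claims (insert (claim c x v) F)"
    using F(2) unfolding closed_claims_def
    by (auto intro: justified_mono[OF _ subset_insertI order_refl])
  then show ?thesis
    unfolding derivable_def using F(1) by (intro exI[of _ "insert (claim c x v) F"]) simp
qed

lemma ev_complete:
  assumes "ev c x = Some v"
  shows "derivable (claim (recf_encode c) x v)"
  using assms
proof (induction c arbitrary: x v)
  case RZero
  then show ?case by (intro derivableI[of "{}"]) (auto simp: justified_def)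
next
  case RSucc
  then show ?case by (intro derivableI[of "{}"]) (auto simp: justified_def)
next
  case RFst
  then show ?case by (intro derivableI[of "{}"]) (auto simp: justified_def)
next
  case RSnd
  then show ?case by (intro derivableI[of "{}"]) (auto simp: justified_def)
next
  case (RPair c d)
  then obtain u w where "ev c x = Some u" "ev d x = Some w" "v = pair u w"
    by (auto simp: bind_eq_Some_conv)
  then show ?case using RPair.IH
    by (intro derivableI[of "{claim (recf_encode c) x u, claim (recf_encode d) x w}"])
      (auto simp: justified_recf_encode)
next
  case (RComp c d)
  then obtain u where "ev d x = Some u" "ev c u = Some v"
    by (auto simp: bind_eq_Some_conv)
  then show ?case using RComp.IH
    by (intro derivableI[of "{claim (recf_encode d) x u, claim (recf_encode c) u v}"])
      (auto simp: justified_recf_encode)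
next
  case (RPrec c d)
  have "derivable (claim (recf_encode (RPrec c d)) (pair a n) v)"
    if "ev (RPrec c d) (pair a n) = Some v" for a n v
    using that
  proof (induction n arbitrary: v)
    case 0
    then show ?case using RPrec.IH
      by (intro derivableI[of "{claim (recf_encode c) a v}"]) (auto simp: justified_recf_encode)
  next
    case (Suc n)
    then obtain r where "ev (RPrec c d) (pair a n) = Some r" "ev d (pair a (pair n r)) = Some v"
      by (auto simp: bind_eq_Some_conv)
    then show ?case using RPrec.IH Suc.IH
      by (intro derivableI[of "{claim (recf_encode (RPrec c d)) (pair a n) r,
            claim (recf_encode d) (pair a (pair n r)) v}"])
        (auto simp: justified_recf_encode)
  qed
  from this[of "pfst x" "psnd x"] show ?case using RPrec.prems by simp
next
  case (RMu c)
  define P where "P n \<longleftrightarrow> ev c (pair x n) = Some 0 \<and>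
      (\<forall>m<n. \<exists>w. ev c (pair x m) = Some (Suc w))" for n
  have "\<exists>n. P n" "v = (LEAST n. P n)"
    using RMu.prems by (auto simp: P_def Let_def split: if_splits)
  then have "P v" by (metis LeastI_ex)
  then obtain h where h: "ev c (pair x v) = Some 0" "\<And>m. m < v \<Longrightarrow> ev c (pair x m) = Some (Suc (h m))"
    unfolding P_def by metis
  show ?case
  proof (rule derivableI)
    \<comment> \<open>The zero at \<open>v\<close> and the positive values at the finitely many
      earlier arguments justify the result of the search.\<close>
    let ?G = "insert (claim (recf_encode c) (pair x v) 0)
        ((\<lambda>m. claim (recf_encode c) (pair x m) (Suc (h m))) ` {..<v})"
    show "finite ?G" by simp
    show "derivable p" if "p \<in> ?G" for p
      using that h RMu.IH by auto
    show "justified ?G UNIV (recf_encode (RMu c)) x v"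
      by (auto simp: justified_recf_encode)
  qed
qed

text \<open>\<open>N\<close> is at once the code of the set of claims and the bound for all
  quantifiers, as \<open>fin_set_le\<close> permits.\<close>

definition cert :: "nat \<Rightarrow> bool" where
  "cert N \<longleftrightarrow> (\<forall>p\<le>N. p \<in> fin_set N \<longrightarrow>
     justified (fin_set N) {..N} (pfst p) (pfst (psnd p)) (psnd (psnd p)))"

lemma cert_iff: "cert N \<longleftrightarrow> closed_claims (fin_set N)"
proof
  assume N: "cert N"
  show "closed_claims (fin_set N)"
    unfolding closed_claims_def
  proof (intro allI impI)
    fix c x v
    assume "claim c x v \<in> fin_set N"
    then have "justified (fin_set N) {..N} c x v"
      using N fin_set_le unfolding cert_def by fastforce
    then show "justified (fin_set N) UNIV c x v"
      by (rule justified_mono) auto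
  qed
next
  assume N: "closed_claims (fin_set N)"
  show "cert N"
    unfolding cert_def
  proof (intro allI impI)
    fix p
    assume "p \<le> N" "p \<in> fin_set N"
    moreover from this have "justified (fin_set N) UNIV (pfst p) (pfst (psnd p)) (psnd (psnd p))"
      using N unfolding closed_claims_def by simp
    ultimately show "justified (fin_set N) {..N} (pfst p) (pfst (psnd p)) (psnd (psnd p))"
      using fin_set_le pfst_le by (intro justified_atMost) (auto intro: order_trans)
  qed
qed

lemma Bex_atMost: "(\<exists>y\<in>{..n}. P y) \<longleftrightarrow> (\<exists>y\<le>n. P y)"
  by auto

lemma decidable_cert: "decidable {N. cert N}"
  unfolding cert_def justified_def Bex_atMost
  by (intro decidable_intros computable_intros)

section \<open>Certificates for the values of closed terms\<close>

abbreviation app_code :: "nat \<Rightarrow> nat \<Rightarrow> nat" where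
  "app_code s t \<equiv> Suc (2 * pair s t)"

text \<open>\<open>F\<close> holds claims about programs, \<open>G\<close> pairs of a term code and
  the value of that term.\<close>

definition term_justified :: "nat set \<Rightarrow> nat set \<Rightarrow> nat set \<Rightarrow> nat \<Rightarrow> nat \<Rightarrow> bool" where
  "term_justified F G B t v \<longleftrightarrow> t = 2 * v \<or>
     (\<exists>r\<in>B. \<exists>s\<in>B. t = app_code r s \<and>
        (\<exists>a\<in>B. \<exists>b\<in>B. pair r a \<in> G \<and> pair s b \<in> G \<and> claim a b v \<in> F))"

lemma term_justified_mono:
  "term_justified F G B t v \<Longrightarrow> F \<subseteq> F' \<Longrightarrow> G \<subseteq> G' \<Longrightarrow> B \<subseteq> B' \<Longrightarrow> term_justified F' G' B' t v"
  unfolding term_justified_def by blast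

definition term_cert :: "nat \<Rightarrow> bool" where
  "term_cert N \<longleftrightarrow> cert (pfst N) \<and> (\<forall>p\<le>N. p \<in> fin_set (psnd N) \<longrightarrow>
     term_justified (fin_set (pfst N)) (fin_set (psnd N)) {..N} (pfst p) (psnd p))"

definition closed_term_claims :: "nat set \<Rightarrow> nat set \<Rightarrow> bool" where
  "closed_term_claims F G \<longleftrightarrow> closed_claims F \<and>
     (\<forall>t v. pair t v \<in> G \<longrightarrow> term_justified F G UNIV t v)"

lemma term_cert_iff: "term_cert N \<longleftrightarrow> closed_term_claims (fin_set (pfst N)) (fin_set (psnd N))"
proof
  assume N: "term_cert N"
  have "term_justified (fin_set (pfst N)) (fin_set (psnd N)) UNIV t v"
    if "pair t v \<in> fin_set (psnd N)" for t v
  proof -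
    have "pair t v \<le> N" using fin_set_le[OF that] psnd_le order_trans by blast
    then have "term_justified (fin_set (pfst N)) (fin_set (psnd N)) {..N} t v"
      using N that unfolding term_cert_def by fastforce
    then show ?thesis by (rule term_justified_mono) auto
  qed
  then show "closed_term_claims (fin_set (pfst N)) (fin_set (psnd N))"
    using N by (auto simp: closed_term_claims_def term_cert_def cert_iff)
next
  assume N: "closed_term_claims (fin_set (pfst N)) (fin_set (psnd N))"
  have "term_justified (fin_set (pfst N)) (fin_set (psnd N)) {..N} t v"
    if tv: "pair t v \<in> fin_set (psnd N)" for t v
  proof -
    have le: "r \<le> N \<and> a \<le> N" if "pair r a \<in> fin_set (psnd N)" for r a
      using fin_set_le[OF that] psnd_le pair_leD order_trans by blast
    have "term_justified (fin_set (pfst N)) (fin_set (psnd N)) UNIV t v"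
      using N tv unfolding closed_term_claims_def by blast
    then show ?thesis
      unfolding term_justified_def
    proof (elim disj_forward, goal_cases)
      case 2
      then obtain r s a b where *: "t = app_code r s" "pair r a \<in> fin_set (psnd N)"
        "pair s b \<in> fin_set (psnd N)" "claim a b v \<in> fin_set (pfst N)" by blast
      then have "r \<in> {..N}" "s \<in> {..N}" "a \<in> {..N}" "b \<in> {..N}"
        using le by auto
      then show ?case using * by blast
    qed
  qed
  then show "term_cert N"
    using N unfolding term_cert_def closed_term_claims_def cert_iff
    by (metis pair_pfst_psnd)
qed

lemma decidable_term_cert: "decidable {N. term_cert N}"
proof -
  have "decidable {x. cert (pfst x)}"
    using decidable_vimage[OF decidable_cert computable_pfst[OF computable_id]] by simp
  then show ?thesis
    unfolding term_cert_def term_justified_def Bex_atMost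
    by (intro decidable_intros computable_intros)
qed

text \<open>Even numbers code elements, odd ones applications of smaller codes. Hence the relations
  can be studied on all numbers without restricting to valid codes.\<close>

lemma surj_cterm_encode: "surj cterm_encode"
proof -
  have "\<exists>t. cterm_encode t = n" for n
  proof (induction n rule: less_induct)
    case (less n)
    show ?case
    proof (cases "even n")
      case True
      then show ?thesis by (metis cterm_encode.simps(1) evenE)
    next
      case False
      then obtain m where m: "n = 2 * m + 1" by (elim oddE)
      then have "pfst m < n" "psnd m < n"
        using pfst_le[of m] psnd_le[of m] by linarith+
      then obtain s t where "cterm_encode s = pfst m" "cterm_encode t = psnd m"
        using less by blast
      then have "cterm_encode (App s t) = n" using m by simp
      then show ?thesis ..
    qed
  qed
  then show ?thesis by (metis surjI)
qed

definition eval_code :: "nat \<Rightarrow> nat option" where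
  "eval_code t = eval_term K1_app (inv cterm_encode t)"

lemma eval_code_encode: "eval_code (cterm_encode s) = eval_term K1_app s"
  by (simp add: eval_code_def inj_cterm_encode)

lemma eval_code_El: "eval_code (2 * a) = Some a"
  using eval_code_encode[of "El a"] by simp

lemma eval_code_app:
  "eval_code (app_code s t) =
     Option.bind (eval_code s) (\<lambda>a. Option.bind (eval_code t) (Phi a))"
proof -
  obtain s' t' where "s = cterm_encode s'" "t = cterm_encode t'"
    using surj_cterm_encode by (metis surjD)
  then show ?thesis
    using eval_code_encode[of "App s' t'"] by (simp add: eval_code_encode K1_app_def)
qed

lemma eval_term_sound:
  assumes "closed_term_claims F G" "pair (cterm_encode s) v \<in> G"
  shows "eval_term K1_app s = Some v"
  using assms(2)
proof (induction s arbitrary: v)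
  case (El a)
  then have "term_justified F G UNIV (2 * a) v"
    using assms(1) unfolding closed_term_claims_def by simp
  then show ?case
    unfolding term_justified_def by (simp add: double_not_eq_Suc_double)
next
  case (App s t)
  then have "term_justified F G UNIV (app_code (cterm_encode s) (cterm_encode t)) v"
    using assms(1) unfolding closed_term_claims_def by simp
  \<comment> \<open>Parity excludes the clause for elements.\<close>
  moreover have "app_code (cterm_encode s) (cterm_encode t) \<noteq> 2 * v" by presburger
  ultimately obtain a b where ab: "pair (cterm_encode s) a \<in> G" "pair (cterm_encode t) b \<in> G"
    "claim a b v \<in> F"
    unfolding term_justified_def by auto
  have "Phi a b = Some v"
    using ev_sound[of F "inv recf_encode a" b v] ab(3) assms(1) surj_recf_encode
    by (simp add: closed_term_claims_def Phi_def surj_f_inv_f)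
  then show ?case using App.IH ab by (simp add: K1_app_def)
qed

lemma eval_term_complete:
  assumes "eval_term K1_app s = Some v"
  shows "\<exists>F G. finite F \<and> finite G \<and> closed_term_claims F G \<and> pair (cterm_encode s) v \<in> G"
  using assms
proof (induction s arbitrary: v)
  case (El a)
  then have "closed_term_claims {} {pair (2 * a) v}"
    by (simp add: closed_term_claims_def closed_claims_def term_justified_def)
  then show ?case by (intro exI[of _ "{}"] exI[of _ "{pair (2 * a) v}"]) simp
next
  case (App s t)
  then obtain a b where ab: "eval_term K1_app s = Some a" "eval_term K1_app t = Some b"
    "K1_app a b = Some v"
    by (auto simp: bind_eq_Some_conv)
  obtain F1 G1 where 1: "finite F1" "finite G1" "closed_term_claims F1 G1"
    "pair (cterm_encode s) a \<in> G1"
    using App.IH(1)[OF ab(1)] by blast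
  obtain F2 G2 where 2: "finite F2" "finite G2" "closed_term_claims F2 G2"
    "pair (cterm_encode t) b \<in> G2"
    using App.IH(2)[OF ab(2)] by blast
  have "derivable (claim a b v)"
    using ev_complete[of "inv recf_encode a" b v] ab(3) surj_recf_encode
    by (simp add: K1_app_def Phi_def surj_f_inv_f)
  then obtain F3 where 3: "finite F3" "closed_claims F3" "claim a b v \<in> F3"
    unfolding derivable_def by blast
  let ?F = "F1 \<union> F2 \<union> F3"
  let ?G = "insert (pair (cterm_encode (App s t)) v) (G1 \<union> G2)"
  have F: "justified ?F UNIV c x w" if "claim c x w \<in> ?F" for c x w
  proof -
    have "\<exists>F\<in>{F1, F2, F3}. justified F UNIV c x w"
      using that 1(3) 2(3) 3(2) unfolding closed_term_claims_def closed_claims_def by blast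
    then show ?thesis by (auto elim!: justified_mono)
  qed
  have G: "term_justified ?F ?G UNIV r w" if "pair r w \<in> ?G" for r w
  proof (cases "pair r w \<in> G1 \<union> G2")
    case True
    then have "term_justified F1 G1 UNIV r w \<or> term_justified F2 G2 UNIV r w"
      using 1(3) 2(3) unfolding closed_term_claims_def by blast
    then show ?thesis by (auto elim!: term_justified_mono)
  next
    case False
    then have "r = app_code (cterm_encode s) (cterm_encode t)" "w = v"
      using that by auto
    then show ?thesis
      unfolding term_justified_def using 1(4) 2(4) 3(3) by blast
  qed
  show ?case
    using F G 1(1,2) 2(1,2) 3(1)
    by (intro exI[of _ ?F] exI[of _ ?G]) (auto simp: closed_term_claims_def closed_claims_def)
qed

lemma eval_code_iff_term_cert:
  "eval_code t = Some v \<longleftrightarrow> (\<exists>N. term_cert N \<and> pair t v \<in> fin_set (psnd N))"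
proof -
  obtain s where s: "t = cterm_encode s"
    using surj_cterm_encode by (metis surjD)
  show ?thesis
  proof
    assume "eval_code t = Some v"
    then obtain F G where "finite F" "finite G" and FG: "closed_term_claims F G" "pair t v \<in> G"
      using eval_term_complete[of s v] by (auto simp: s eval_code_encode)
    then obtain M N where "fin_set M = F" "fin_set N = G"
      using ex_fin_set by metis
    then show "\<exists>N. term_cert N \<and> pair t v \<in> fin_set (psnd N)"
      using FG by (intro exI[of _ "pair M N"]) (simp add: term_cert_iff)
  qed (auto simp: s eval_code_encode term_cert_iff intro: eval_term_sound)
qed

text \<open>This plays the role of Kleene's T predicate for terms: a decidable relation whose
  projection along \<open>N\<close> is the graph of evaluation.\<close>

definition eval_step :: "nat \<Rightarrow> nat \<Rightarrow> nat \<Rightarrow> bool" where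
  "eval_step t v N \<longleftrightarrow> term_cert N \<and> pair t v \<in> fin_set (psnd N)"

lemma eval_code_iff_step: "eval_code t = Some v \<longleftrightarrow> (\<exists>N. eval_step t v N)"
  by (simp add: eval_code_iff_term_cert eval_step_def)

lemma decidable_eval_step:
  assumes "computable t" "computable v" "computable N"
  shows "decidable {x. eval_step (t x) (v x) (N x)}"
proof -
  have "decidable {x. term_cert (N x)}"
    using decidable_vimage[OF decidable_term_cert assms(3)] by simp
  then show ?thesis
    unfolding eval_step_def by (intro decidable_intros computable_intros assms)
qed

text \<open>Minimisation searches for a coded pair of a value and a witness, and the first
  projection returns the value. By the second hypothesis any pair found carries the right
  value.\<close>

lemma ev_of_graph:
  assumes R: "decidable {q. R (pfst q) (pfst (psnd q)) (psnd (psnd q))}"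
    and f: "\<And>x v. f x = Some v \<longleftrightarrow> (\<exists>N. R x v N)"
  shows "\<exists>c. ev c = f"
proof -
  \<comment> \<open>The test is negated because \<open>RMu\<close> looks for a zero; being total, it
    never blocks the search.\<close>
  have "computable (\<lambda>q. if \<not> R (pfst q) (pfst (psnd q)) (psnd (psnd q)) then 1 else 0)"
    by (intro computable_if decidable_not R computable_const)
  then obtain c where c: "\<And>q. ev c q =
      Some (if \<not> R (pfst q) (pfst (psnd q)) (psnd (psnd q)) then 1 else 0)"
    by (rule computableE) blast
  define P where "P x w \<longleftrightarrow> R x (pfst w) (psnd w)" for x w
  have P: "ev c (pair x w) = Some 0 \<longleftrightarrow> P x w"
    "(\<exists>v. ev c (pair x w) = Some (Suc v)) \<longleftrightarrow> \<not> P x w" for x w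
    by (auto simp: c P_def)
  have mu: "ev (RMu c) x = (if \<exists>w. P x w then Some (LEAST w. P x w) else None)" for x
  proof (cases "\<exists>w. P x w")
    case True
    define w where "w = (LEAST w. P x w)"
    have w: "P x w" using True unfolding w_def by (metis LeastI_ex)
    have less: "\<not> P x m" if "m < w" for m
      using that unfolding w_def by (rule not_less_Least)
    have "(LEAST w. P x w \<and> (\<forall>m<w. \<not> P x m)) = w"
      using w less by (intro Least_equality) (auto simp: not_less[symmetric])
    moreover have "\<exists>w. P x w \<and> (\<forall>m<w. \<not> P x m)" using w less by blast
    ultimately show ?thesis using True by (simp add: P w_def del: not_ex)
  next
    case False
    then show ?thesis by (simp add: P Let_def)
  qed
  have "ev (RComp RFst (RMu c)) x = f x" for x
  proof (cases "f x")
    case None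
    then have "\<not> (\<exists>w. P x w)" using f by (simp add: P_def) (metis option.distinct(1))
    then show ?thesis using None by (simp add: mu del: ev.simps(8))
  next
    case (Some v)
    then obtain N where "R x v N" using f by blast
    then have ex: "\<exists>w. P x w" unfolding P_def by (intro exI[of _ "pair v N"]) simp
    then have "P x (LEAST w. P x w)" by (metis LeastI_ex)
    then have "f x = Some (pfst (LEAST w. P x w))" using f unfolding P_def by blast
    then show ?thesis using ex by (simp add: mu del: ev.simps(8))
  qed
  then show ?thesis by blast
qed

text \<open>This takes the place of a universal function: evaluating a computably given term is
  itself partial computable.\<close>

lemma ev_eval_code:
  assumes "computable g"
  shows "\<exists>c. \<forall>x. ev c x = eval_code (g x)"
proof -
  have "\<exists>c. ev c = (\<lambda>x. eval_code (g x))"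
    by (rule ev_of_graph[where R = "\<lambda>x. eval_step (g x)"])
      (intro decidable_eval_step computable_intros computable_comp[OF assms],
        rule eval_code_iff_step)
  then show ?thesis by metis
qed

section \<open>The relations on codes\<close>

definition csim :: "nat \<Rightarrow> nat \<Rightarrow> nat \<Rightarrow> nat \<Rightarrow> bool" where
  "csim k n s t \<longleftrightarrow> pair s t \<in> K1_sim (omega_times_plus k n)"

lemma csim_encode:
  "csim k n (cterm_encode s) (cterm_encode t) \<longleftrightarrow> sim K1_app (omega_times_plus k n) s t"
  using inj_cterm_encode by (auto simp: csim_def K1_sim_def inj_eq)

lemma K1_sim_eq: "K1_sim (omega_times_plus k n) = {p. csim k n (pfst p) (psnd p)}"
  by (simp add: csim_def)

lemma csim_zero: "csim 0 0 s t \<longleftrightarrow> eval_code s = eval_code t"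
proof -
  obtain s' t' where "s = cterm_encode s'" "t = cterm_encode t'"
    using surj_cterm_encode by (metis surjD)
  then show ?thesis
    by (simp add: csim_encode eval_code_encode sim_zero_iff[OF is_zero_omega] kleene_eq_def)
      (metis option.exhaust)
qed

lemma csim_Suc:
  "csim k (Suc n) s t \<longleftrightarrow> (\<forall>x. csim k n (app_code s (2 * x)) (app_code t (2 * x)))"
proof -
  obtain s' t' where "s = cterm_encode s'" "t = cterm_encode t'"
    using surj_cterm_encode by (metis surjD)
  moreover have "sim K1_app (omega_times_plus k n) (App s' (El x)) (App t' (El x)) \<longleftrightarrow>
    csim k n (app_code (cterm_encode s') (2 * x)) (app_code (cterm_encode t') (2 * x))" for x
    using csim_encode[of k n "App s' (El x)" "App t' (El x)"] by simp
  ultimately show ?thesis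
    by (simp add: csim_encode sim_succ_iff[OF is_succ_of_omega])
qed

lemma csim_limit_below: "csim (Suc k) 0 s t \<longleftrightarrow> (\<exists>j\<le>k. \<exists>n. csim j n s t)"
proof -
  obtain s' t' where "s = cterm_encode s'" "t = cterm_encode t'"
    using surj_cterm_encode by (metis surjD)
  then show ?thesis
    using sim_limit_iff[OF is_limit_omega, of K1_app k s' t']
    by (auto simp: csim_encode omega_times_plus_def less_prod_def less_Suc_eq_le)
qed

text \<open>Kleene equality survives application to an element, and successor stages inherit this.
  At a limit, the witnessing stage is raised by one and stays below the limit.\<close>

lemma csim_step: "csim k n s t \<Longrightarrow> csim k (Suc n) s t"
proof (induction k arbitrary: n s t rule: less_induct)
  case (less k)
  have zero: "csim k 0 s t \<Longrightarrow> csim k (Suc 0) s t" for s t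
  proof (cases k)
    case 0
    then show "csim k 0 s t \<Longrightarrow> csim k (Suc 0) s t"
      by (simp add: csim_Suc csim_zero eval_code_app)
  next
    case (Suc k')
    assume "csim k 0 s t"
    then obtain j n where "j \<le> k'" "csim j n s t" using Suc csim_limit_below by blast
    then have "csim j (Suc n) s t" using less Suc by simp
    then show "csim k (Suc 0) s t"
      using \<open>j \<le> k'\<close> unfolding Suc csim_Suc csim_limit_below by blast
  qed
  from less.prems show ?case
  proof (induction n arbitrary: s t)
    case (Suc n)
    then show ?case unfolding csim_Suc[of k "Suc n"] csim_Suc[of k n s t] by blast
  qed (rule zero)
qed

lemma csim_mono_nat: "csim k n s t \<Longrightarrow> n \<le> m \<Longrightarrow> csim k m s t"
  by (induction m) (auto simp: le_Suc_eq csim_step)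

lemma csim_mono_limit: "j \<le> k \<Longrightarrow> csim j n s t \<Longrightarrow> \<exists>m. csim k m s t"
proof (induction k)
  case 0
  then show ?case by auto
next
  case (Suc k)
  then show ?case
    by (metis csim_limit_below le_Suc_eq)
qed

text \<open>The stages \<omega>k + n are cofinal below \<omega>(k + 1), so a limit costs just one
  number quantifier.\<close>

lemma csim_limit: "csim (Suc k) 0 s t \<longleftrightarrow> (\<exists>n. csim k n s t)"
  using csim_limit_below csim_mono_limit by blast

text \<open>The value of an application depends only on the values of its parts, so no stage can
  tell apart terms with equal values. This permits reducing terms under the relation.\<close>

lemma csim_cong:
  assumes "csim k n s t" "eval_code s = eval_code s'" "eval_code t = eval_code t'"
  shows "csim k n s' t'"
  using assms
proof (induction k arbitrary: n s t s' t')
  case 0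
  then show ?case
    by (induction n arbitrary: s t s' t')
      (simp add: csim_zero, simp only: csim_Suc, metis eval_code_app)
next
  case (Suc k)
  show ?case
    using Suc.prems
  proof (induction n arbitrary: s t s' t')
    case 0
    then show ?case unfolding csim_limit using Suc.IH by blast
  next
    case (Suc n)
    then show ?case by (simp only: csim_Suc) (metis eval_code_app)
  qed
qed

lemma csim_eval_cong:
  "eval_code s = eval_code s' \<Longrightarrow> eval_code t = eval_code t' \<Longrightarrow> csim k n s t \<longleftrightarrow> csim k n s' t'"
  using csim_cong by metis

section \<open>Application to a coded tuple of arguments\<close>

definition app_list :: "nat \<Rightarrow> nat \<Rightarrow> nat \<Rightarrow> nat" where
  "app_list s n l = rec_nat s (\<lambda>i r. app_code r (2 * entry l i)) n"

lemma app_list_cong: "(\<And>i. i < n \<Longrightarrow> entry l i = entry l' i) \<Longrightarrow> app_list s n l = app_list s n l'"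
  by (induction n) (simp_all add: app_list_def)

text \<open>The \<open>n\<close> quantifiers of \<open>n\<close> successor stages merge into one
  over coded tuples, so that \<open>n\<close> can later be an input rather than a fixed
  number.\<close>

lemma csim_app_list:
  "csim k (m + n) s t \<longleftrightarrow> (\<forall>l. csim k m (app_list s n l) (app_list t n l))"
proof (induction n arbitrary: m)
  case 0
  show ?case by (simp add: app_list_def)
next
  case (Suc n)
  have app: "app_list s (Suc n) l = app_code (app_list s n l) (2 * entry l n)" for s l
    by (simp add: app_list_def)
  have "(\<forall>l. csim k m (app_list s (Suc n) l) (app_list t (Suc n) l)) \<longleftrightarrow>
      (\<forall>l x. csim k m (app_code (app_list s n l) (2 * x)) (app_code (app_list t n l) (2 * x)))"
  proof (intro iffI allI)
    fix l x
    assume *: "\<forall>l. csim k m (app_list s (Suc n) l) (app_list t (Suc n) l)"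
    \<comment> \<open>The new code extends the first \<open>n\<close> entries of \<open>l\<close> by
      \<open>x\<close>.\<close>
    obtain l' where "\<forall>i<Suc n. entry l' i = (if i < n then entry l i else x)"
      using ex_entries[of "Suc n" "\<lambda>i. if i < n then entry l i else x"] by blast
    then have "entry l' n = x" "\<And>i. i < n \<Longrightarrow> entry l' i = entry l i" by auto
    then have "app_list s (Suc n) l' = app_code (app_list s n l) (2 * x)" for s
      unfolding app using app_list_cong[of n l' l s] by simp
    then show "csim k m (app_code (app_list s n l) (2 * x)) (app_code (app_list t n l) (2 * x))"
      using * by metis
  qed (simp add: app)
  also have "\<dots> \<longleftrightarrow> csim k (m + Suc n) s t"
    using Suc.IH[of "Suc m"] unfolding csim_Suc[of k m] by simp
  finally show ?case by simp
qed

section \<open>Upper bounds\<close>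

lemma Sigma0_SucI: "B \<in> Pi0 n \<Longrightarrow> A = {x. \<exists>y. pair x y \<in> B} \<Longrightarrow> A \<in> Sigma0 (Suc n)"
  by auto

lemma Pi0_SucI: "B \<in> Sigma0 n \<Longrightarrow> A = {x. \<forall>y. pair x y \<in> B} \<Longrightarrow> A \<in> Pi0 (Suc n)"
  by auto

lemma vimage_Sigma0_Pi0:
  assumes "computable f"
  shows "(A \<in> Sigma0 n \<longrightarrow> {x. f x \<in> A} \<in> Sigma0 n) \<and> (A \<in> Pi0 n \<longrightarrow> {x. f x \<in> A} \<in> Pi0 n)"
  using assms
proof (induction n arbitrary: A f)
  case 0
  then show ?case by (simp add: decidable_vimage)
next
  case (Suc n)
  \<comment> \<open>The substitution acts on the free variable and keeps the quantified one.\<close>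
  let ?g = "\<lambda>p. pair (f (pfst p)) (psnd p)"
  have g: "computable ?g"
    by (intro computable_intros computable_comp[OF Suc.prems])
  have "{x. f x \<in> A} \<in> Sigma0 (Suc n)" if A: "A \<in> Sigma0 (Suc n)"
  proof -
    obtain B where "B \<in> Pi0 n" "A = {x. \<exists>y. pair x y \<in> B}" using A by auto
    then show ?thesis
      using Suc.IH[OF g, of B] by (auto intro!: bexI[of _ "{p. ?g p \<in> B}"])
  qed
  moreover have "{x. f x \<in> A} \<in> Pi0 (Suc n)" if A: "A \<in> Pi0 (Suc n)"
  proof -
    obtain B where "B \<in> Sigma0 n" "A = {x. \<forall>y. pair x y \<in> B}" using A by auto
    then show ?thesis
      using Suc.IH[OF g, of B] by (auto intro!: bexI[of _ "{p. ?g p \<in> B}"])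
  qed
  ultimately show ?case by blast
qed

lemma Sigma0_vimage: "A \<in> Sigma0 n \<Longrightarrow> computable f \<Longrightarrow> {x. f x \<in> A} \<in> Sigma0 n"
  using vimage_Sigma0_Pi0 by blast

lemma Pi0_vimage: "A \<in> Pi0 n \<Longrightarrow> computable f \<Longrightarrow> {x. f x \<in> A} \<in> Pi0 n"
  using vimage_Sigma0_Pi0 by blast

lemma Sigma0_ex:
  assumes "A \<in> Sigma0 (Suc n)"
  shows "{x. \<exists>y. pair x y \<in> A} \<in> Sigma0 (Suc n)"
proof -
  obtain B where B: "B \<in> Pi0 n" "A = {x. \<exists>y. pair x y \<in> B}" using assms by auto
  \<comment> \<open>Two existential quantifiers contract to one over pairs; \<open>?f\<close>
    reassociates x, (y, z) to (x, y), z.\<close>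
  let ?f = "\<lambda>p. pair (pair (pfst p) (pfst (psnd p))) (psnd (psnd p))"
  have "{p. ?f p \<in> B} \<in> Pi0 n"
    by (intro Pi0_vimage B computable_intros)
  moreover have "{x. \<exists>y. pair x y \<in> A} = {x. \<exists>w. pair x w \<in> {p. ?f p \<in> B}}"
    by (auto simp: B) (metis fst_conv snd_conv prod_encode_inverse)
  ultimately show ?thesis by (rule Sigma0_SucI)
qed

lemma Pi0_all:
  assumes "A \<in> Pi0 (Suc n)"
  shows "{x. \<forall>y. pair x y \<in> A} \<in> Pi0 (Suc n)"
proof -
  obtain B where B: "B \<in> Sigma0 n" "A = {x. \<forall>y. pair x y \<in> B}" using assms by auto
  let ?f = "\<lambda>p. pair (pair (pfst p) (pfst (psnd p))) (psnd (psnd p))"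
  have "{p. ?f p \<in> B} \<in> Sigma0 n"
    by (intro Sigma0_vimage B computable_intros)
  moreover have "{x. \<forall>y. pair x y \<in> A} = {x. \<forall>w. pair x w \<in> {p. ?f p \<in> B}}"
    by (auto simp: B) (metis fst_conv snd_conv prod_encode_inverse)
  ultimately show ?thesis by (rule Pi0_SucI)
qed

lemma kleene_eq_Pi0: "{p. csim 0 0 (pfst p) (psnd p)} \<in> Pi0 2"
proof -
  \<comment> \<open>A computation \<open>M\<close> giving \<open>v\<close> for one term must be
    matched by a computation \<open>N\<close> for the other. Quantifying over \<open>v\<close> and
    \<open>M\<close> as one pair leaves the prefix \<forall>\<exists>.\<close>
  define R where "R s t v M N \<longleftrightarrow>
    (eval_step s v M \<longrightarrow> eval_step t v N) \<and> (eval_step t v M \<longrightarrow> eval_step s v N)" for s t v M N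
  have "csim 0 0 s t \<longleftrightarrow> (\<forall>w. \<exists>N. R s t (pfst w) (psnd w) N)" for s t
  proof
    assume "csim 0 0 s t"
    then have "(\<exists>N. eval_step s v N) \<longleftrightarrow> (\<exists>N. eval_step t v N)" for v
      by (simp add: csim_zero flip: eval_code_iff_step)
    then show "\<forall>w. \<exists>N. R s t (pfst w) (psnd w) N"
      \<comment> \<open>A single \<open>N\<close> serves both implications: if both premises hold,
        \<open>M\<close> itself works, and otherwise one of them is vacuous.\<close>
      unfolding R_def by metis
  next
    assume *: "\<forall>w. \<exists>N. R s t (pfst w) (psnd w) N"
    have "\<exists>N. R s t v M N" for v M
      using *[rule_format, of "pair v M"] by simp
    then have "eval_code s = Some v \<longleftrightarrow> eval_code t = Some v" for v
      unfolding eval_code_iff_step R_def by blast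
    then show "csim 0 0 s t"
      unfolding csim_zero by (metis option.exhaust)
  qed
  then have eq: "{p. csim 0 0 (pfst p) (psnd p)} = {p. \<forall>w. pair p w \<in> {q. \<exists>N. pair q N \<in>
      {r. R (pfst (pfst (pfst r))) (psnd (pfst (pfst r)))
        (pfst (psnd (pfst r))) (psnd (psnd (pfst r))) (psnd r)}}}"
    by simp
  have "decidable {r. R (pfst (pfst (pfst r))) (psnd (pfst (pfst r)))
        (pfst (psnd (pfst r))) (psnd (psnd (pfst r))) (psnd r)}"
    unfolding R_def by (intro decidable_intros decidable_eval_step computable_intros)
  then have "{r. R (pfst (pfst (pfst r))) (psnd (pfst (pfst r)))
        (pfst (psnd (pfst r))) (psnd (psnd (pfst r))) (psnd r)} \<in> Pi0 0" by simp
  then show ?thesis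
    unfolding eq numeral_2_eq_2 by (intro Pi0_SucI[OF _ refl] Sigma0_SucI[OF _ refl])
qed

lemma computable_app_list:
  assumes "computable s" "computable n" "computable l"
  shows "computable (\<lambda>x. app_list (s x) (n x) (l x))"
  unfolding app_list_def
  by (intro computable_rec_nat computable_intros assms computable_comp[OF assms(3)])

text \<open>In the second set the finite part of the stage is an input, because the next limit
  quantifies over it.\<close>

lemma csim_bounds:
  "{p. csim (Suc k) 0 (pfst p) (psnd p)} \<in> Sigma0 (2 * Suc k + 1) \<and>
   {q. csim k (pfst q) (pfst (psnd q)) (psnd (psnd q))} \<in> Pi0 (2 * k + 2)"
proof (induction k)
  have step: "{q. csim k (pfst q) (pfst (psnd q)) (psnd (psnd q))} \<in> Pi0 (2 * k + 2)"
    (is "?U \<in> _")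
    if "{p. csim k 0 (pfst p) (psnd p)} \<in> Pi0 (2 * k + 2) \<or>
      {p. csim k 0 (pfst p) (psnd p)} \<in> Sigma0 (2 * k + 1)" (is "?A \<in> _ \<or> _") for k
  proof -
    let ?f = "\<lambda>r. pair (app_list (pfst (psnd (pfst r))) (pfst (pfst r)) (psnd r))
      (app_list (psnd (psnd (pfst r))) (pfst (pfst r)) (psnd r))"
    have f: "computable ?f" by (intro computable_intros computable_app_list)
    have U: "?U = {q. \<forall>l. pair q l \<in> {r. ?f r \<in> ?A}}"
      by (simp add: csim_app_list[of k 0, unfolded add_0, symmetric])
    have suc: "2 * k + 2 = Suc (2 * k + 1)" by simp
    from that show ?thesis
    \<comment> \<open>A leading \<forall> over tuples is absorbed by a \<Pi> class, the case of
      stage 0, and otherwise raises a \<Sigma> class by one level.\<close>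
    proof
      assume "?A \<in> Pi0 (2 * k + 2)"
      then have "{r. ?f r \<in> ?A} \<in> Pi0 (Suc (2 * k + 1))"
        unfolding suc by (rule Pi0_vimage) (rule f)
      then show ?thesis unfolding suc U by (rule Pi0_all)
    next
      assume "?A \<in> Sigma0 (2 * k + 1)"
      then have "{r. ?f r \<in> ?A} \<in> Sigma0 (2 * k + 1)" using Sigma0_vimage f by blast
      then have "?U \<in> Pi0 (Suc (2 * k + 1))" using U by (rule Pi0_SucI)
      then show ?thesis unfolding suc .
    qed
  qed
  have limit: "{p. csim (Suc k) 0 (pfst p) (psnd p)} \<in> Sigma0 (2 * Suc k + 1)"
    if "{q. csim k (pfst q) (pfst (psnd q)) (psnd (psnd q))} \<in> Pi0 (2 * k + 2)" (is "?U \<in> _")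
    for k
  proof -
    let ?f = "\<lambda>r. pair (psnd r) (pfst r)"
    have "{r. ?f r \<in> ?U} \<in> Pi0 (2 * k + 2)"
      by (rule Pi0_vimage[OF that]) (intro computable_intros)
    moreover have "{p. csim (Suc k) 0 (pfst p) (psnd p)} = {p. \<exists>n. pair p n \<in> {r. ?f r \<in> ?U}}"
      by (simp add: csim_limit)
    ultimately have "{p. csim (Suc k) 0 (pfst p) (psnd p)} \<in> Sigma0 (Suc (2 * k + 2))"
      by (rule Sigma0_SucI)
    moreover have "2 * Suc k + 1 = Suc (2 * k + 2)" by simp
    ultimately show ?thesis by (simp only:)
  qed
  {
    case 0
    have "{p. csim 0 0 (pfst p) (psnd p)} \<in> Pi0 (2 * 0 + 2)"
      using kleene_eq_Pi0 by (simp only: mult_0_right add_0)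
    then show ?case using step[of 0] limit[of 0] by blast
  next
    case (Suc k)
    then show ?case using step[of "Suc k"] limit[of "Suc k"] by blast
  }
qed

lemma K1_sim_limit_Sigma0: "k > 0 \<Longrightarrow> K1_sim (omega_times_plus k 0) \<in> Sigma0 (2 * k + 1)"
  using csim_bounds[of "k - 1"] by (simp add: K1_sim_eq del: Sigma0.simps)

lemma K1_sim_Pi0: "K1_sim (omega_times_plus k n) \<in> Pi0 (2 * k + 2)"
proof -
  have "{p. pair n p \<in> {q. csim k (pfst q) (pfst (psnd q)) (psnd (psnd q))}} \<in> Pi0 (2 * k + 2)"
    using csim_bounds[of k] by (intro Pi0_vimage computable_intros) simp
  then show ?thesis by (simp add: K1_sim_eq)
qed

section \<open>Lower bounds\<close>

primrec const_recf :: "nat \<Rightarrow> recf" where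
  "const_recf 0 = RZero"
| "const_recf (Suc n) = RComp RSucc (const_recf n)"

lemma ev_const_recf: "ev (const_recf n) x = Some n"
  by (induction n) auto

lemma computable_const_recf: "computable (\<lambda>x. recf_encode (const_recf x))"
proof -
  \<comment> \<open>\<open>RSucc\<close> has code 1, so each further composition with it is one
    arithmetic operation on codes.\<close>
  have "rec_nat 0 (\<lambda>_ r. 4 * pair 1 r + 5) n = recf_encode (const_recf n)" for n
    by (induction n) auto
  moreover have "computable (\<lambda>x. rec_nat 0 (\<lambda>_ r. 4 * pair 1 r + 5) x)"
    by (intro computable_rec_nat computable_intros)
  ultimately show ?thesis by simp
qed

text \<open>The program \<open>c\<close> is composed with one that pairs the hard-wired constant
  \<open>x\<close> with the input.\<close>

lemma s_m_n: "\<exists>S. computable S \<and> (\<forall>x y. Phi (S x) y = ev c (pair x y))"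
proof -
  define S where "S x = recf_encode (RComp c (RPair (const_recf x) (RPair RFst RSnd)))" for x
  have "computable S"
    unfolding S_def recf_encode.simps by (intro computable_intros computable_const_recf)
  moreover have "Phi (S x) y = ev c (pair x y)" for x y
    unfolding S_def Phi_recf_encode by (simp add: ev_const_recf)
  ultimately show ?thesis by blast
qed

text \<open>Lambda abstraction over \<open>y\<close>, uniform in the parameter \<open>x\<close>; the
  terms for successor and limit stages are built with it.\<close>

lemma ex_lambda:
  assumes "computable g"
  shows "\<exists>S. computable S \<and> (\<forall>x y. Phi (S x) y = eval_code (g (pair x y)))"
  using ev_eval_code[OF assms] s_m_n by metis

lemma csim_Suc_lambda:
  assumes "\<And>x. Phi a x = eval_code (s x)" "\<And>x. Phi b x = eval_code (t x)"
  shows "csim k (Suc n) (2 * a) (2 * b) \<longleftrightarrow> (\<forall>x. csim k n (s x) (t x))"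
  unfolding csim_Suc
  by (intro all_cong1 csim_eval_cong) (simp_all add: eval_code_app eval_code_El assms)

definition K :: "nat \<Rightarrow> nat" where
  "K = (SOME S. computable S \<and> (\<forall>x y. Phi (S x) y = Some x))"

lemma K: "computable K" "Phi (K x) y = Some x"
proof -
  have "\<exists>S. computable S \<and> (\<forall>x y. Phi (S x) y = Some x)"
    using s_m_n[of RFst] by simp
  then have "computable K \<and> (\<forall>x y. Phi (K x) y = Some x)"
    unfolding K_def by (rule someI_ex)
  then show "computable K" "Phi (K x) y = Some x" by auto
qed

lemma computable_K_funpow:
  assumes "computable f" "computable g"
  shows "computable (\<lambda>x. (K ^^ f x) (g x))"
proof -
  have "(K ^^ n) v = rec_nat v (\<lambda>_. K) n" for n v
    by (induction n) auto
  then show ?thesis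
    using assms by (simp, intro computable_rec_nat computable_comp[OF K(1)] computable_intros)
qed

lemma csim_Suc_K: "csim k (Suc n) (2 * K a) (2 * K b) \<longleftrightarrow> csim k n (2 * a) (2 * b)"
  using csim_Suc_lambda[of "K a" "\<lambda>_. 2 * a" "K b" "\<lambda>_. 2 * b" k n]
  by (simp add: K eval_code_El)

text \<open>One \<open>K\<close> shifts the witnessing stage by one, which goes unnoticed below a
  limit.\<close>

lemma csim_limit_K: "csim (Suc k) 0 (2 * K a) (2 * K b) \<longleftrightarrow> csim (Suc k) 0 (2 * a) (2 * b)"
  unfolding csim_limit using csim_Suc_K csim_step by blast

text \<open>Each \<open>K\<close> delays the successor stages by one but leaves the limit stage as
  it is. Since \<open>a\<close> and \<open>b\<close> are related one stage after the limit at the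
  latest, only \<open>n > m\<close> matters when they are unrelated at the limit.\<close>

lemma csim_K_funpow:
  assumes "csim (Suc k) 1 (2 * a) (2 * b)"
  shows "csim (Suc k) n (2 * (K ^^ m) a) (2 * (K ^^ m) b) \<longleftrightarrow>
    csim (Suc k) 0 (2 * a) (2 * b) \<or> n > m"
proof (induction m arbitrary: n)
  case 0
  show ?case
    using assms csim_mono_nat[of "Suc k" 1 "2 * a" "2 * b" n]
      csim_mono_nat[of "Suc k" 0 "2 * a" "2 * b" n]
    by (cases n) auto
next
  case (Suc m)
  show ?case
  proof (cases n)
    case 0
    then show ?thesis using Suc.IH[of 0] by (simp add: csim_limit_K)
  next
    case (Suc n')
    then show ?thesis using Suc.IH[of n'] by (simp add: csim_Suc_K)
  qed
qed

text \<open>The successor function has no zero, so the search never ends.\<close>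

definition nowhere :: nat where
  "nowhere = recf_encode (RMu RSucc)"

lemma Phi_nowhere: "Phi nowhere x = None"
  unfolding nowhere_def Phi_recf_encode by simp

text \<open>An undefined term and the code of the nowhere defined function become related after one
  application, and each \<open>K\<close> delays this by one step.\<close>

lemma csim_undefined:
  assumes "eval_code s = None"
  shows "csim 0 n s (2 * (K ^^ m) nowhere) \<longleftrightarrow> n > m"
  using assms
proof (induction m arbitrary: n s)
  case 0
  show ?case
  proof (cases n)
    case 0
    then show ?thesis using \<open>eval_code s = None\<close> by (simp add: csim_zero eval_code_El)
  next
    case (Suc n')
    have "csim 0 0 (app_code s (2 * x)) (app_code (2 * nowhere) (2 * x))" for x
      using \<open>eval_code s = None\<close> by (simp add: csim_zero eval_code_app eval_code_El Phi_nowhere)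
    then have "csim 0 n' (app_code s (2 * x)) (app_code (2 * nowhere) (2 * x))" for x
      by (rule csim_mono_nat) simp
    then show ?thesis using Suc by (simp add: csim_Suc)
  qed
next
  case (Suc m)
  show ?case
  proof (cases n)
    case 0
    then show ?thesis using Suc.prems by (simp add: csim_zero eval_code_El)
  next
    case (Suc n')
    have "csim 0 n' (app_code s (2 * x)) (app_code (2 * (K ^^ Suc m) nowhere) (2 * x)) \<longleftrightarrow>
        csim 0 n' (app_code s (2 * x)) (2 * (K ^^ m) nowhere)" for x
      by (rule csim_eval_cong) (simp_all add: eval_code_app eval_code_El K)
    also have "\<dots>x \<longleftrightarrow> n' > m" for x
      using Suc.prems by (intro Suc.IH) (simp add: eval_code_app)
    finally show ?thesis using Suc by (simp add: csim_Suc)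
  qed
qed

text \<open>The induction of the hardness proof goes through because the two terms are always related
  from \<open>\<omega>k + m + 1\<close> on, for an \<open>m\<close> that can be chosen.\<close>

definition separable :: "nat \<Rightarrow> nat set \<Rightarrow> bool" where
  "separable k A \<longleftrightarrow> (\<exists>F G. computable F \<and> computable G \<and>
     (\<forall>x m n. csim k n (F (pair x m)) (G (pair x m)) \<longleftrightarrow> x \<in> A \<or> n > m))"

lemma separable_Sigma0_1:
  assumes "A \<in> Sigma0 1"
  shows "separable 0 A"
proof -
  obtain B where B: "decidable B" "A = {x. \<exists>y. pair x y \<in> B}"
    using assms by auto
  \<comment> \<open>A witness for membership in \<open>A\<close> releases exactly the value that
    \<open>G\<close> will have.\<close>
  define R where "R p v y \<longleftrightarrow> pair (pfst p) y \<in> B \<and> v = (K ^^ psnd p) nowhere" for p v y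
  define f where "f p = (if pfst p \<in> A then Some ((K ^^ psnd p) nowhere) else None)" for p
  have "decidable {q. pair (pfst (pfst q)) (psnd (psnd q)) \<in> B}"
    by (intro decidable_vimage B computable_intros)
  then have "decidable {q. R (pfst q) (pfst (psnd q)) (psnd (psnd q))}"
    unfolding R_def by (intro decidable_intros computable_K_funpow computable_intros)
  moreover have "f p = Some v \<longleftrightarrow> (\<exists>y. R p v y)" for p v
    by (auto simp: f_def R_def B)
  ultimately obtain c where c: "ev c = f" using ev_of_graph by blast
  \<comment> \<open>\<open>F\<close> is an unevaluated application, which may be undefined, whereas
    \<open>G\<close> is the code of an element.\<close>
  define F where "F p = app_code (2 * recf_encode c) (2 * p)" for p
  define G where "G p = 2 * (K ^^ psnd p) nowhere" for p
  have F: "eval_code (F p) = f p" for p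
    by (simp add: F_def eval_code_app eval_code_El Phi_recf_encode c)
  have "csim 0 n (F (pair x m)) (G (pair x m)) \<longleftrightarrow> x \<in> A \<or> n > m" for x m n
  proof (cases "x \<in> A")
    case True
    then have "csim 0 0 (F (pair x m)) (G (pair x m))"
      by (simp add: csim_zero F f_def G_def eval_code_El)
    then show ?thesis using True csim_mono_nat by blast
  next
    case False
    then show ?thesis
      using csim_undefined[of "F (pair x m)" n m] by (simp add: F f_def G_def)
  qed
  moreover have "computable F" "computable G"
    unfolding F_def G_def by (intro computable_intros computable_K_funpow)+
  ultimately show ?thesis unfolding separable_def by blast
qed

text \<open>Abstracting over \<open>z\<close> makes the successor stage supply the quantifier
  \<forall>z, and the alternative \<open>n > m\<close> passes through because it does not mention
  \<open>z\<close>.\<close>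

lemma csim_Suc_of_separable:
  assumes "separable k D"
  shows "\<exists>S T. computable S \<and> computable T \<and> (\<forall>p m n.
    csim k (Suc n) (2 * S (pair p m)) (2 * T (pair p m)) \<longleftrightarrow> (\<forall>z. pair p z \<in> D) \<or> n > m)"
proof -
  obtain F G where FG: "computable F" "computable G"
    "\<And>x m n. csim k n (F (pair x m)) (G (pair x m)) \<longleftrightarrow> x \<in> D \<or> n > m"
    using assms unfolding separable_def by blast
  \<comment> \<open>This rearranges (p, m), z into (p, z), m.\<close>
  define h where "h r = pair (pair (pfst (pfst r)) (psnd r)) (psnd (pfst r))" for r
  have h: "computable h" unfolding h_def by (intro computable_intros)
  obtain S where S: "computable S" "\<And>x y. Phi (S x) y = eval_code (F (h (pair x y)))"
    using ex_lambda[OF computable_comp[OF FG(1) h]] by blast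
  obtain T where T: "computable T" "\<And>x y. Phi (T x) y = eval_code (G (h (pair x y)))"
    using ex_lambda[OF computable_comp[OF FG(2) h]] by blast
  have "csim k (Suc n) (2 * S (pair p m)) (2 * T (pair p m)) \<longleftrightarrow> (\<forall>z. pair p z \<in> D) \<or> n > m"
    for p m n
    unfolding csim_Suc_lambda[OF S(2) T(2)] by (simp add: h_def FG(3))
  then show ?thesis using S(1) T(1) by blast
qed

text \<open>The witness of the outer quantifier is replaced by an upper bound for it; the resulting
  bounded quantifier is moved inwards by quantifying over finite sequences.\<close>

lemma Sigma0_monotone_form:
  assumes "A \<in> Sigma0 (Suc (Suc (Suc n)))"
  shows "\<exists>D \<in> Sigma0 (Suc n). \<forall>x.
    (x \<in> A \<longleftrightarrow> (\<exists>m. \<forall>l. pair (pair x m) l \<in> D)) \<and>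
    (\<forall>m m'. m \<le> m' \<longrightarrow> (\<forall>l. pair (pair x m) l \<in> D) \<longrightarrow> (\<forall>l. pair (pair x m') l \<in> D))"
proof -
  obtain C where C: "C \<in> Pi0 (Suc (Suc n))" "A = {x. \<exists>y. pair x y \<in> C}"
    using assms by (auto simp del: Pi0.simps)
  obtain B where B: "B \<in> Sigma0 (Suc n)" "C = {p. \<forall>z. pair p z \<in> B}"
    using C(1) by (auto simp del: Sigma0.simps)
  \<comment> \<open>The double truncated subtraction is the minimum of the witness and
    \<open>m\<close>, so an unbounded \<exists>y expresses the bounded one.\<close>
  define g where "g q = (let x = pfst (pfst (pfst q)); m = psnd (pfst (pfst q)); l = psnd (pfst q);
      y = psnd q - (psnd q - m) in pair (pair x y) (entry l y))" for q
  have g: "computable g" unfolding g_def Let_def by (intro computable_intros)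
  define D where "D = {r. \<exists>y. pair r y \<in> {q. g q \<in> B}}"
  have D: "D \<in> Sigma0 (Suc n)"
    unfolding D_def by (intro Sigma0_ex Sigma0_vimage B g)
  have mem_D: "pair (pair x m) l \<in> D \<longleftrightarrow> (\<exists>y\<le>m. pair (pair x y) (entry l y) \<in> B)" for x m l
  proof
    assume "pair (pair x m) l \<in> D"
    then obtain y where "pair (pair x (y - (y - m))) (entry l (y - (y - m))) \<in> B"
      unfolding D_def g_def Let_def by auto
    then show "\<exists>y\<le>m. pair (pair x y) (entry l y) \<in> B"
      by (intro exI[of _ "y - (y - m)"]) auto
  next
    assume "\<exists>y\<le>m. pair (pair x y) (entry l y) \<in> B"
    then obtain y where "y \<le> m" "pair (pair x y) (entry l y) \<in> B" by blast
    then show "pair (pair x m) l \<in> D"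
      unfolding D_def g_def Let_def by (auto intro!: exI[of _ y])
  qed
  have all_D: "(\<forall>l. pair (pair x m) l \<in> D) \<longleftrightarrow> (\<exists>y\<le>m. pair x y \<in> C)" for x m
  proof
    assume *: "\<forall>l. pair (pair x m) l \<in> D"
    show "\<exists>y\<le>m. pair x y \<in> C"
    proof (rule ccontr)
      assume "\<not> (\<exists>y\<le>m. pair x y \<in> C)"
      \<comment> \<open>Each \<open>y\<close> up to \<open>m\<close> has a counterexample; listing
        them all in one sequence refutes the assumption.\<close>
      then obtain z where z: "\<And>y. y \<le> m \<Longrightarrow> pair (pair x y) (z y) \<notin> B"
        unfolding B(2) mem_Collect_eq by metis
      obtain l where "\<forall>i<Suc m. entry l i = z i" using ex_entries[of "Suc m" z] by blast
      then show False using * z unfolding mem_D by (metis less_Suc_eq_le)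
    qed
  qed (auto simp: mem_D B(2))
  show ?thesis
  proof (intro bexI[OF _ D] allI conjI impI)
    show "x \<in> A \<longleftrightarrow> (\<exists>m. \<forall>l. pair (pair x m) l \<in> D)" for x
      unfolding all_D C(2) by auto
    show "pair (pair x m') l \<in> D" if "m \<le> m'" "\<forall>l. pair (pair x m) l \<in> D" for x m m' l
      using that all_D[of x m] all_D[of x m'] order_trans by blast
  qed
qed

lemma separable_step:
  assumes IH: "\<And>D. D \<in> Sigma0 (Suc n) \<Longrightarrow> separable k D"
    and A: "A \<in> Sigma0 (Suc (Suc (Suc n)))"
  shows "separable (Suc k) A"
proof -
  obtain D where D: "D \<in> Sigma0 (Suc n)"
    "\<And>x. x \<in> A \<longleftrightarrow> (\<exists>m. \<forall>l. pair (pair x m) l \<in> D)"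
    "\<And>x m m'. m \<le> m' \<Longrightarrow> (\<forall>l. pair (pair x m) l \<in> D) \<Longrightarrow> (\<forall>l. pair (pair x m') l \<in> D)"
    using Sigma0_monotone_form[OF A] by (elim bexE) blast
  obtain S T where ST: "computable S" "computable T"
    "\<And>p m n. csim k (Suc n) (2 * S (pair p m)) (2 * T (pair p m)) \<longleftrightarrow>
      (\<forall>z. pair p z \<in> D) \<or> n > m"
    using csim_Suc_of_separable[OF IH[OF D(1)]] by blast
  \<comment> \<open>Here \<open>r\<close> is the pair of \<open>x\<close> and \<open>m\<close>; thus
    \<open>m\<close> serves both as the outer witness and as the delay.\<close>
  have "computable (\<lambda>r. 2 * S (pair r (psnd r)))"
    by (intro computable_intros computable_comp[OF ST(1)])
  then obtain S' where S': "computable S'"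
    "\<And>x m. Phi (S' x) m = eval_code (2 * S (pair (pair x m) m))"
    using ex_lambda[of "\<lambda>r. 2 * S (pair r (psnd r))"] by auto
  have "computable (\<lambda>r. 2 * T (pair r (psnd r)))"
    by (intro computable_intros computable_comp[OF ST(2)])
  then obtain T' where T': "computable T'"
    "\<And>x m. Phi (T' x) m = eval_code (2 * T (pair (pair x m) m))"
    using ex_lambda[of "\<lambda>r. 2 * T (pair r (psnd r))"] by auto
  have level: "csim k (Suc (Suc n)) (2 * S' x) (2 * T' x) \<longleftrightarrow>
      (\<forall>m. (\<forall>z. pair (pair x m) z \<in> D) \<or> n > m)" for x n
    unfolding csim_Suc_lambda[OF S'(2) T'(2)] ST(3) ..
  have zero: "csim (Suc k) 0 (2 * S' x) (2 * T' x) \<longleftrightarrow> x \<in> A" for x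
  proof
    assume "csim (Suc k) 0 (2 * S' x) (2 * T' x)"
    then obtain n where "csim k n (2 * S' x) (2 * T' x)" unfolding csim_limit ..
    \<comment> \<open>The stage is raised by two to fit \<open>level\<close>; its instance at
      \<open>m = n\<close> then yields the witness.\<close>
    then have "csim k (Suc (Suc n)) (2 * S' x) (2 * T' x)" by (rule csim_mono_nat) simp
    then show "x \<in> A" unfolding level D(2) by blast
  next
    assume "x \<in> A"
    then obtain m where m: "\<forall>z. pair (pair x m) z \<in> D" unfolding D(2) by blast
    have "csim k (Suc (Suc m)) (2 * S' x) (2 * T' x)"
      unfolding level using D(3)[OF _ m] not_less by blast
    then show "csim (Suc k) 0 (2 * S' x) (2 * T' x)" unfolding csim_limit by blast
  qed
  have one: "csim (Suc k) 1 (2 * S' x) (2 * T' x)" for x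
  proof -
    \<comment> \<open>Past its delay \<open>m\<close>, each instance is related whatever
      \<open>D\<close> says. These stages grow with \<open>m\<close>, but all lie below the
      limit.\<close>
    have "csim k (Suc (Suc m)) (2 * S (pair (pair x m) m)) (2 * T (pair (pair x m) m))" for m
      unfolding ST(3) by simp
    then have "csim (Suc k) 0 (2 * S (pair (pair x m) m)) (2 * T (pair (pair x m) m))" for m
      unfolding csim_limit by blast
    then show ?thesis
      unfolding One_nat_def csim_Suc_lambda[OF S'(2) T'(2)] ..
  qed
  define F where "F p = 2 * (K ^^ psnd p) (S' (pfst p))" for p
  define G where "G p = 2 * (K ^^ psnd p) (T' (pfst p))" for p
  have "csim (Suc k) n (F (pair x m)) (G (pair x m)) \<longleftrightarrow> x \<in> A \<or> n > m" for x m n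
    using csim_K_funpow[OF one] by (simp add: F_def G_def zero)
  moreover have "computable F" "computable G"
    unfolding F_def G_def
    by (intro computable_intros computable_K_funpow computable_comp[OF S'(1)]
        computable_comp[OF T'(1)])+
  ultimately show ?thesis unfolding separable_def by blast
qed

lemma separable_Sigma0: "A \<in> Sigma0 (2 * k + 1) \<Longrightarrow> separable k A"
proof (induction k arbitrary: A)
  case 0
  then show ?case using separable_Sigma0_1 by simp
next
  case (Suc k)
  then show ?case using separable_step[of "2 * k" k A] by (simp del: Sigma0.simps)
qed

section \<open>Reductions and completeness\<close>

lemma many_one_reducible_K1_sim:
  assumes "computable F" "computable G" "\<And>x. x \<in> A \<longleftrightarrow> csim k n (F x) (G x)"
  shows "many_one_reducible A (K1_sim (omega_times_plus k n))"
  unfolding many_one_reducible_def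
  using assms by (intro exI[of _ "\<lambda>x. pair (F x) (G x)"]) (auto simp: csim_def computable_pair)

lemma Sigma0_reducible_K1_sim:
  assumes "A \<in> Sigma0 (2 * k + 1)"
  shows "many_one_reducible A (K1_sim (omega_times_plus k 0))"
proof -
  obtain F G where FG: "computable F" "computable G"
    "\<And>x m n. csim k n (F (pair x m)) (G (pair x m)) \<longleftrightarrow> x \<in> A \<or> n > m"
    using separable_Sigma0[OF assms] unfolding separable_def by blast
  show ?thesis
  proof (rule many_one_reducible_K1_sim)
    \<comment> \<open>With delay and stage both 0, the alternative \<open>n > m\<close> fails and
      membership in \<open>A\<close> remains.\<close>
    show "computable (\<lambda>x. F (pair x 0))" "computable (\<lambda>x. G (pair x 0))"
      by (intro computable_comp[OF FG(1)] computable_comp[OF FG(2)] computable_intros)+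
  qed (simp add: FG(3))
qed

lemma Pi0_reducible_K1_sim:
  assumes "A \<in> Pi0 (2 * k + 2)"
  shows "many_one_reducible A (K1_sim (omega_times_plus k (Suc n)))"
proof -
  obtain D where D: "D \<in> Sigma0 (2 * k + 1)" "A = {x. \<forall>z. pair x z \<in> D}"
    using assms by (auto simp del: Sigma0.simps)
  obtain S T where ST: "computable S" "computable T"
    "\<And>p m n. csim k (Suc n) (2 * S (pair p m)) (2 * T (pair p m)) \<longleftrightarrow>
      (\<forall>z. pair p z \<in> D) \<or> n > m"
    using csim_Suc_of_separable[OF separable_Sigma0[OF D(1)]] by blast
  show ?thesis
  proof (rule many_one_reducible_K1_sim)
    \<comment> \<open>The delay is chosen as \<open>n\<close>, so at stage \<open>Suc n\<close> the
      alternative reads \<open>n > n\<close> and fails.\<close>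
    show "computable (\<lambda>x. 2 * S (pair x n))" "computable (\<lambda>x. 2 * T (pair x n))"
      by (intro computable_intros computable_comp[OF ST(1)] computable_comp[OF ST(2)])+
  qed (simp add: ST(3) D(2))
qed

theorem theorem6p7:
  shows "(\<forall>k>0. complete_for (Sigma0 (2 * k + 1)) (K1_sim (omega_times_plus k 0))) \<and>
         (\<forall>k. \<forall>n>0. complete_for (Pi0 (2 * k + 2)) (K1_sim (omega_times_plus k n)))"
  unfolding complete_for_def
  using K1_sim_limit_Sigma0 K1_sim_Pi0 Sigma0_reducible_K1_sim Pi0_reducible_K1_sim gr0_conv_Suc
  by metis

end
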